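(* Let $(H,\Delta,\epsilon,\Phi,S,\alpha,\beta)$ be a quasi-Hopf algebra with bijective antipode, with Drinfeld twist $F_\delta$ and second Drinfeld twist $F_0=(S^{-1}\otimes S^{-1})F_\delta^T$. Then the Drinfeld twist $F_\delta^0$ of the opposite quasi-Hopf algebra $H^{cop}=(H,\Delta^T,\epsilon,\Phi^T,S^{-1},S^{-1}(\alpha),S^{-1}(\beta))$ is given explicitly by $$F_\delta^0=(S^{-1}\otimes S^{-1})F_\delta=F_0^T .$$
   Context: A quasi-bialgebra $(H,\Delta,\epsilon,\Phi)$ over a field $k$ is a unital associative $k$-algebra $H$ with algebra homomorphisms $\epsilon:H\to k$, $\Delta:H\to H\otimes H$ and an invertible $\Phi\in H\otimes H\otimes H$ such that (with $1$ also denoting the identity map) $(1\otimes\Delta)\Delta(a)=\Phi^{-1}(\Delta\otimes 1)\Delta(a)\Phi$ for all $a\in H$; $(\Delta\otimes 1\otimes 1)\Phi\cdot(1\otimes 1\otimes\Delta)\Phi=(\Phi\otimes 1)\cdot(1\otimes\Delta\otimes 1)\Phi\cdot(1\otimes\Phi)$; $(\epsilon\otimes 1)\Delta=1=(1\otimes\epsilon)\Delta$; $(1\otimes\epsilon\otimes 1)\Phi=1$. Write $\Phi=\sum_\nu X_\nu\otimes Y_\nu\otimes Z_\nu$, $\Phi^{-1}=\sum_\nu\bar X_\nu\otimes\bar Y_\nu\otimes\bar Z_\nu$, $\Delta(a)=\sum a_{(1)}\otimes a_{(2)}$. A quasi-Hopf algebra $(H,\Delta,\epsilon,\Phi,S,\alpha,\beta)$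 is a quasi-bialgebra with an algebra anti-homomorphism $S:H\to H$ (assumed bijective) and $\alpha,\beta\in H$ such that $\sum S(X_\nu)\alpha Y_\nu\beta S(Z_\nu)=1=\sum\bar X_\nu\beta S(\bar Y_\nu)\alpha\bar Z_\nu$ and $\sum S(a_{(1)})\alpha a_{(2)}=\epsilon(a)\alpha$, $\sum a_{(1)}\beta S(a_{(2)})=\epsilon(a)\beta$ for all $a\in H$. $T$ is the flip $T(a\otimes b)=b\otimes a$, $\Delta^T=T\circ\Delta$, $F^T=T(F)$ for $F\in H\otimes H$, and $\Phi^T=\Phi_{321}^{-1}=\sum\bar Z_\nu\otimes\bar Y_\nu\otimes\bar X_\nu$. The Drinfeld twist of a quasi-Hopf algebra $(H,\Delta,\epsilon,\Phi,S,\alpha,\beta)$ is $$F_\delta=\sum_\nu (S\otimes S)\Delta^T(X_\nu)\cdot\gamma\cdot\Delta(Y_\nu\beta S(Z_\nu))=\sum_\nu\Delta'(\bar X_\nu\beta S(\bar Y_\nu))\cdot\gamma\cdot\Delta(\bar Z_\nu),$$ where $\Delta'(a)=(S\otimes S)\Delta^T(S^{-1}(a))$, $\gamma=\sum_i S(B_i)\alpha C_i\otimes S(A_i)\alpha D_i$, and $\sum_i A_i\otimes B_i\otimes C_i\otimes D_i$ is either $(\Phi^{-1}\otimes 1)\cdot(\Delta\otimes 1\otimes 1)\Phi$ or $(1\otimes\Phi)\cdot(1\otimes 1\otimes\Delta)\Phi^{-1}$ (both give the same $\gamma$; the two expressions for $F_\delta$ are known to agree). The Drinfeld twist $F_\delta^0$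 of $H^{cop}$ is given by the same formulas with $(\Delta,\Phi,S,\alpha,\beta)$ replaced by $(\Delta^T,\Phi^T,S^{-1},S^{-1}(\alpha),S^{-1}(\beta))$. *)

theory Defs
  imports Complex_Main "HOL-Library.Poly_Mapping"
begin

text \<open>
  The tensor powers of \<open>H\<close> are realised inside the tensor algebra of \<open>H\<close>: the free vector space on
  the words over \<open>H\<close>, modulo the subspace of multilinear relations. The class of the word
  \<open>[a\<^sub>1, \<dots>, a\<^sub>n]\<close> is \<open>a\<^sub>1 \<otimes> \<dots> \<otimes> a\<^sub>n\<close>, and the \<open>n\<close>-th tensor power is the homogeneous part of degree
  \<open>n\<close>. This makes the tensor product strictly associative, with the field as zeroth power.
  Tensors are cosets, i.e. sets of elements of the free vector space.
\<close>

type_synonym ('k, 'h) tensor = "('h list \<Rightarrow>\<^sub>0 'k) set"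

definition free_scale :: "'k::field \<Rightarrow> ('x \<Rightarrow>\<^sub>0 'k) \<Rightarrow> ('x \<Rightarrow>\<^sub>0 'k)"
  where "free_scale c f = Poly_Mapping.map ((*) c) f"

lemma lookup_free_scale [simp]: "Poly_Mapping.lookup (free_scale c f) x = c * Poly_Mapping.lookup f x"
  by (simp add: free_scale_def Poly_Mapping.map.rep_eq when_def)

lemma vector_space_free_scale: "vector_space (free_scale :: 'k::field \<Rightarrow> ('x \<Rightarrow>\<^sub>0 'k) \<Rightarrow> _)"
  by unfold_locales (auto intro!: poly_mapping_eqI simp: Poly_Mapping.lookup_add algebra_simps)

text \<open>A unital associative algebra over a field. Since \<open>ring_1\<close> includes \<open>0 \<noteq> 1\<close>, the zero algebra is
  excluded; it admits no unital homomorphism to a field, so carries no counit.\<close>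

locale k_algebra = vector_space scale
  for scale :: "'k::field \<Rightarrow> 'h::ring_1 \<Rightarrow> 'h" (infixr \<open>*s\<close> 75) +
  assumes scale_mult_left: "(c *s a) * b = c *s (a * b)"
    and scale_mult_right: "a * (c *s b) = c *s (a * b)"
begin

definition relations :: "('h list \<Rightarrow>\<^sub>0 'k) set" where
  "relations =
     {Poly_Mapping.single (us @ [a + b] @ vs) 1 - Poly_Mapping.single (us @ [a] @ vs) 1
        - Poly_Mapping.single (us @ [b] @ vs) 1 | us a b vs. True}
   \<union> {Poly_Mapping.single (us @ [c *s a] @ vs) 1 - Poly_Mapping.single (us @ [a] @ vs) c
        | us c a vs. True}"

definition coset :: "('h list \<Rightarrow>\<^sub>0 'k) \<Rightarrow> ('k, 'h) tensor" where
  "coset f = {g. g - f \<in> module.span free_scale relations}"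

definition tensor_power :: "nat \<Rightarrow> ('k, 'h) tensor set" where
  "tensor_power n = coset ` {f. \<forall>xs \<in> Poly_Mapping.keys f. length xs = n}"

definition pure_tensor :: "'h list \<Rightarrow> ('k, 'h) tensor" where
  "pure_tensor xs = coset (Poly_Mapping.single xs 1)"

definition tensor_one :: "nat \<Rightarrow> ('k, 'h) tensor" where
  "tensor_one n = pure_tensor (replicate n 1)"

definition representative :: "('k, 'h) tensor \<Rightarrow> ('h list \<Rightarrow>\<^sub>0 'k)" where
  "representative t = (SOME f. f \<in> t)"

definition tensor_zero :: "('k, 'h) tensor" where
  "tensor_zero = coset 0"

definition tensor_add :: "('k, 'h) tensor \<Rightarrow> ('k, 'h) tensor \<Rightarrow> ('k, 'h) tensor" where
  "tensor_add s t = coset (representative s + representative t)"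

definition tensor_scale :: "'k \<Rightarrow> ('k, 'h) tensor \<Rightarrow> ('k, 'h) tensor" where
  "tensor_scale c t = coset (free_scale c (representative t))"

text \<open>The linear maps on tensors that send \<open>a\<^sub>1 \<otimes> \<dots> \<otimes> a\<^sub>n\<close> to \<open>\<phi> [a\<^sub>1, \<dots>, a\<^sub>n]\<close>, with values in \<open>H\<close>
  and in tensors. They do not depend on the choice of representative provided that \<open>\<phi>\<close> is
  multilinear in words of each length; whenever \<open>\<phi>\<close> is meant for words of one length only, it is
  therefore set to zero on the words of any other length.\<close>

definition contract :: "('h list \<Rightarrow> 'h) \<Rightarrow> ('k, 'h) tensor \<Rightarrow> 'h" where
  "contract \<phi> t = (\<Sum>xs\<in>Poly_Mapping.keys (representative t). Poly_Mapping.lookup (representative t) xs *s \<phi> xs)"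

definition extend :: "('h list \<Rightarrow> ('k, 'h) tensor) \<Rightarrow> ('k, 'h) tensor \<Rightarrow> ('k, 'h) tensor" where
  "extend \<phi> t = coset (\<Sum>xs\<in>Poly_Mapping.keys (representative t).
     free_scale (Poly_Mapping.lookup (representative t) xs) (representative (\<phi> xs)))"

definition tensor_product :: "('k, 'h) tensor \<Rightarrow> ('k, 'h) tensor \<Rightarrow> ('k, 'h) tensor"
    (infixr \<open>\<boxtimes>\<close> 72) where
  "s \<boxtimes> t = extend (\<lambda>xs. extend (\<lambda>ys. pure_tensor (xs @ ys)) t) s"

text \<open>The factorwise product of the algebra \<open>H \<otimes> \<dots> \<otimes> H\<close>.\<close>

definition tensor_mult :: "('k, 'h) tensor \<Rightarrow> ('k, 'h) tensor \<Rightarrow> ('k, 'h) tensor"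
    (infixl \<open>\<odot>\<close> 70) where
  "s \<odot> t = extend (\<lambda>xs. extend (\<lambda>ys.
     if length xs = length ys then pure_tensor (map2 (*) xs ys) else tensor_zero) t) s"

definition is_tensor_inverse :: "nat \<Rightarrow> ('k, 'h) tensor \<Rightarrow> ('k, 'h) tensor \<Rightarrow> bool" where
  "is_tensor_inverse n t u \<longleftrightarrow>
     u \<in> tensor_power n \<and> t \<odot> u = tensor_one n \<and> u \<odot> t = tensor_one n"

definition tensor_inverse :: "nat \<Rightarrow> ('k, 'h) tensor \<Rightarrow> ('k, 'h) tensor" where
  "tensor_inverse n t = (THE u. is_tensor_inverse n t u)"

text \<open>\<open>tensor_map [f\<^sub>1, \<dots>, f\<^sub>n] = f\<^sub>1 \<otimes> \<dots> \<otimes> f\<^sub>n\<close>, where each \<open>f\<^sub>i\<close> maps \<open>H\<close> linearly to some tensor power.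
  The identity of \<open>H\<close> is entered as \<open>\<iota> : H \<rightarrow> H\<^sup>\<otimes>\<^sup>1\<close>, the counit as a map to the zeroth power.\<close>

definition tensor_map :: "('h \<Rightarrow> ('k, 'h) tensor) list \<Rightarrow> ('k, 'h) tensor \<Rightarrow> ('k, 'h) tensor" where
  "tensor_map fs = extend (\<lambda>xs.
     if length xs = length fs then foldr (\<boxtimes>) (map2 (\<lambda>f x. f x) fs xs) (pure_tensor [])
     else tensor_zero)"

definition \<iota> :: "'h \<Rightarrow> ('k, 'h) tensor" where
  "\<iota> a = pure_tensor [a]"

definition scalar :: "'k \<Rightarrow> ('k, 'h) tensor" where
  "scalar c = coset (Poly_Mapping.single [] c)"

text \<open>\<open>a\<^sub>1 \<otimes> \<dots> \<otimes> a\<^sub>n \<mapsto> a\<^sub>n \<otimes> \<dots> \<otimes> a\<^sub>1\<close>: on \<open>H \<otimes> H\<close> the flip, on \<open>H \<otimes> H \<otimes> H\<close> the operation \<open>\<Phi> \<mapsto> \<Phi>\<^sub>3\<^sub>2\<^sub>1\<close>.\<close>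

definition reverse_tensor :: "('k, 'h) tensor \<Rightarrow> ('k, 'h) tensor" where
  "reverse_tensor = extend (\<lambda>xs. pure_tensor (rev xs))"

definition map_both :: "('h \<Rightarrow> 'h) \<Rightarrow> ('k, 'h) tensor \<Rightarrow> ('k, 'h) tensor" where
  "map_both f = tensor_map [\<lambda>a. \<iota> (f a), \<lambda>a. \<iota> (f a)]"

definition op_coproduct :: "('h \<Rightarrow> ('k, 'h) tensor) \<Rightarrow> 'h \<Rightarrow> ('k, 'h) tensor" where
  "op_coproduct \<Delta> a = reverse_tensor (\<Delta> a)"

definition op_associator :: "('k, 'h) tensor \<Rightarrow> ('k, 'h) tensor" where
  "op_associator \<Phi> = reverse_tensor (tensor_inverse 3 \<Phi>)"

text \<open>With \<open>\<Phi> = \<Sum> X \<otimes> Y \<otimes> Z\<close> and \<open>\<Sum> A \<otimes> B \<otimes> C \<otimes> D = (\<Phi>\<^sup>-\<^sup>1 \<otimes> 1) (\<Delta> \<otimes> 1 \<otimes> 1)\<Phi>\<close>, the Drinfeld twist is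
  \<open>\<Sum> (S \<otimes> S) \<Delta>\<^sup>T(X) \<gamma> \<Delta>(Y \<beta> S(Z))\<close> where \<open>\<gamma> = \<Sum> S(B) \<alpha> C \<otimes> S(A) \<alpha> D\<close>. The alternative expressions, with
  \<open>(1 \<otimes> \<Phi>) (1 \<otimes> 1 \<otimes> \<Delta>)\<Phi>\<^sup>-\<^sup>1\<close> in \<open>\<gamma>\<close> and
  \<open>\<Sum> \<Delta>'(X' \<beta> S(Y')) \<gamma> \<Delta>(Z')\<close> with \<open>\<Phi>\<^sup>-\<^sup>1 = \<Sum> X' \<otimes> Y' \<otimes> Z'\<close> for the twist, agree with these in
  every quasi-Hopf algebra with bijective antipode; no definition uses them.\<close>

definition drinfeld_gamma ::
    "('h \<Rightarrow> ('k, 'h) tensor) \<Rightarrow> ('k, 'h) tensor \<Rightarrow> ('h \<Rightarrow> 'h) \<Rightarrow> 'h \<Rightarrow> ('k, 'h) tensor" where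
  "drinfeld_gamma \<Delta> \<Phi> S \<alpha> =
     extend (\<lambda>xs. case xs of
         [a, b, c, d] \<Rightarrow> pure_tensor [S b * \<alpha> * c, S a * \<alpha> * d]
       | _ \<Rightarrow> tensor_zero)
     ((tensor_inverse 3 \<Phi> \<boxtimes> \<iota> 1) \<odot> tensor_map [\<Delta>, \<iota>, \<iota>] \<Phi>)"

definition drinfeld_twist ::
    "('h \<Rightarrow> ('k, 'h) tensor) \<Rightarrow> ('k, 'h) tensor \<Rightarrow> ('h \<Rightarrow> 'h) \<Rightarrow> 'h \<Rightarrow> 'h \<Rightarrow> ('k, 'h) tensor" where
  "drinfeld_twist \<Delta> \<Phi> S \<alpha> \<beta> =
     extend (\<lambda>xs. case xs of
         [x, y, z] \<Rightarrow>
           map_both S (op_coproduct \<Delta> x) \<odot> drinfeld_gamma \<Delta> \<Phi> S \<alpha> \<odot> \<Delta> (y * \<beta> * S z)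
       | _ \<Rightarrow> tensor_zero) \<Phi>"

definition second_drinfeld_twist ::
    "('h \<Rightarrow> ('k, 'h) tensor) \<Rightarrow> ('k, 'h) tensor \<Rightarrow> ('h \<Rightarrow> 'h) \<Rightarrow> 'h \<Rightarrow> 'h \<Rightarrow> ('k, 'h) tensor" where
  "second_drinfeld_twist \<Delta> \<Phi> S \<alpha> \<beta> =
     map_both (inv S) (reverse_tensor (drinfeld_twist \<Delta> \<Phi> S \<alpha> \<beta>))"

end

locale quasi_bialgebra = k_algebra scale
  for scale :: "'k::field \<Rightarrow> 'h::ring_1 \<Rightarrow> 'h" (infixr \<open>*s\<close> 75) +
  fixes \<Delta> :: "'h \<Rightarrow> ('k, 'h) tensor"
    and \<epsilon> :: "'h \<Rightarrow> 'k"
    and \<Phi> :: "('k, 'h) tensor"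
  assumes counit_linear: "Vector_Spaces.linear scale (*) \<epsilon>"
    and counit_one: "\<epsilon> 1 = 1"
    and counit_mult: "\<epsilon> (a * b) = \<epsilon> a * \<epsilon> b"
    and coproduct_in_power: "\<Delta> a \<in> tensor_power 2"
    and coproduct_add: "\<Delta> (a + b) = tensor_add (\<Delta> a) (\<Delta> b)"
    and coproduct_scale: "\<Delta> (c *s a) = tensor_scale c (\<Delta> a)"
    and coproduct_one: "\<Delta> 1 = tensor_one 2"
    and coproduct_mult: "\<Delta> (a * b) = \<Delta> a \<odot> \<Delta> b"
    and associator_in_power: "\<Phi> \<in> tensor_power 3"
    and associator_invertible: "\<exists>\<Psi>. is_tensor_inverse 3 \<Phi> \<Psi>"
    and quasi_coassociative:
      "tensor_map [\<iota>, \<Delta>] (\<Delta> a)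
         = tensor_inverse 3 \<Phi> \<odot> tensor_map [\<Delta>, \<iota>] (\<Delta> a) \<odot> \<Phi>"
    and pentagon:
      "tensor_map [\<Delta>, \<iota>, \<iota>] \<Phi> \<odot> tensor_map [\<iota>, \<iota>, \<Delta>] \<Phi>
         = (\<Phi> \<boxtimes> \<iota> 1) \<odot> tensor_map [\<iota>, \<Delta>, \<iota>] \<Phi> \<odot> (\<iota> 1 \<boxtimes> \<Phi>)"
    and counit_left: "tensor_map [\<lambda>b. scalar (\<epsilon> b), \<iota>] (\<Delta> a) = \<iota> a"
    and counit_right: "tensor_map [\<iota>, \<lambda>b. scalar (\<epsilon> b)] (\<Delta> a) = \<iota> a"
    and counit_associator: "tensor_map [\<iota>, \<lambda>b. scalar (\<epsilon> b), \<iota>] \<Phi> = tensor_one 2"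

locale quasi_hopf_algebra = quasi_bialgebra scale \<Delta> \<epsilon> \<Phi>
  for scale :: "'k::field \<Rightarrow> 'h::ring_1 \<Rightarrow> 'h" (infixr \<open>*s\<close> 75)
    and \<Delta> :: "'h \<Rightarrow> ('k, 'h) tensor"
    and \<epsilon> :: "'h \<Rightarrow> 'k"
    and \<Phi> :: "('k, 'h) tensor" +
  fixes S :: "'h \<Rightarrow> 'h"
    and \<alpha> \<beta> :: 'h
  assumes antipode_linear: "Vector_Spaces.linear scale scale S"
    and antipode_one: "S 1 = 1"
    and antipode_mult: "S (a * b) = S b * S a"
    and antipode_bij: "bij S"
    and antipode_associator:
      "contract (\<lambda>xs. case xs of [x, y, z] \<Rightarrow> S x * \<alpha> * y * \<beta> * S z | _ \<Rightarrow> 0) \<Phi> = 1"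
    and antipode_associator_inverse:
      "contract (\<lambda>xs. case xs of [x, y, z] \<Rightarrow> x * \<beta> * S y * \<alpha> * z | _ \<Rightarrow> 0)
         (tensor_inverse 3 \<Phi>) = 1"
    and antipode_left:
      "contract (\<lambda>xs. case xs of [x, y] \<Rightarrow> S x * \<alpha> * y | _ \<Rightarrow> 0) (\<Delta> a) = \<epsilon> a *s \<alpha>"
    and antipode_right:
      "contract (\<lambda>xs. case xs of [x, y] \<Rightarrow> x * \<beta> * S y | _ \<Rightarrow> 0) (\<Delta> a) = \<epsilon> a *s \<beta>"

end

theory Submission
  imports Defs
begin

text \<open>
  Since \<open>S\<^sup>-\<^sup>1\<close> is an anti-homomorphism, and since \<open>\<Phi>\<^sup>T\<close> is the reversed inverse of \<open>\<Phi>\<close>, unfolding the twist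
  of \<open>H\<^sup>c\<^sup>o\<^sup>p\<close> gives \<open>S\<^sup>-\<^sup>1 \<otimes> S\<^sup>-\<^sup>1\<close> applied to the twist of \<open>H\<close>, but written with the other one of each of
  the two classical pairs of formulas: \<open>\<gamma>\<close> appears as computed from \<open>(1 \<otimes> \<Phi>) (1 \<otimes> 1 \<otimes> \<Delta>)\<Phi>\<^sup>-\<^sup>1\<close>, and the twist
  appears as \<open>\<Sum> \<Delta>'(X' \<beta> S(Y')) \<gamma> \<Delta>(Z')\<close> with \<open>\<Phi>\<^sup>-\<^sup>1 = \<Sum> X' \<otimes> Y' \<otimes> Z'\<close>. So the first equation amounts to
  the agreement of the two formulas in each pair. The second equation only says that the flip is an
  involution which commutes with \<open>S\<^sup>-\<^sup>1 \<otimes> S\<^sup>-\<^sup>1\<close>.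

  The two formulas for \<open>\<gamma>\<close> agree because the pentagon turns the first four-fold tensor into
  \<open>(1 \<otimes> \<Delta> \<otimes> 1)\<Phi>\<close> times the second, and \<open>\<Sum> S(y\<^sub>1) \<alpha> y\<^sub>2 = \<epsilon>(y) \<alpha>\<close> with \<open>(1 \<otimes> \<epsilon> \<otimes> 1)\<Phi> = 1\<close> removes that
  factor (\<open>pairing_gamma_alt\<close>).

  For the two formulas for the twist, the only property of \<open>\<gamma>\<close> that matters is
  \<open>\<Sum> (S \<otimes> S)\<Delta>\<^sup>T(a\<^sub>1) \<gamma> \<Delta>(a\<^sub>2) = \<epsilon>(a) \<gamma>\<close> (\<open>gamma_invariant\<close>): it makes \<open>\<gamma>\<close> play the role of \<open>\<alpha>\<close> for the
  anti-homomorphism \<open>(S \<otimes> S)\<Delta>\<^sup>T\<close> from \<open>H\<close> to \<open>H \<otimes> H\<close>. Tested against a linear form \<open>h\<close> on \<open>H \<otimes> H\<close>, it says that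
  the bilinear form \<open>\<tau>(p, q) = h((S \<otimes> S)\<Delta>\<^sup>T(p) \<gamma> \<Delta>(q))\<close> on \<open>H\<close> is invariant, that is,
  \<open>\<Sum> \<tau>(a\<^sub>1 p, a\<^sub>2 q) = \<epsilon>(a) \<tau>(p, q)\<close>. For every invariant \<open>\<tau>\<close> one has
  \<open>\<Sum> \<tau>(X, Y \<beta> S(Z)) = \<Sum> \<tau>(S\<^sup>-\<^sup>1(X' \<beta> S(Y')), Z')\<close> (\<open>invariant_form_twist\<close>). This is Drinfeld's uniqueness
  of the antipode up to a twist, in a form that does not mention the target algebra: put
  \<open>\<Theta>(p, c) = \<Sum> \<tau>(X p, Y \<beta> S(Z) c)\<close>. Quasi-coassociativity gives \<open>\<Theta>(1, S(a) c) = \<Theta>(a, c)\<close>, the pentagon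
  gives \<open>\<Theta>(p, \<alpha> c) = \<tau>(p, c)\<close>, and expanding \<open>1 = \<Sum> X' \<beta> S(Y') \<alpha> Z'\<close> in \<open>\<Theta>(1, 1)\<close> proves the claim.

  All calculations evaluate tensors on multilinear forms with values in the field. Multilinear forms
  separate tensors (\<open>coset_eqI\<close>), and every operation on tensors becomes a nesting of evaluations. In
  Sweedler notation, \<open>pairing2 (\<lambda>x y. f x y) (\<Delta> a)\<close> is \<open>\<Sum> f(a\<^sub>1, a\<^sub>2)\<close>, and
  \<open>pairing3 (\<lambda>X Y Z. f X Y Z) \<Phi>\<close> is \<open>\<Sum> f(X, Y, Z)\<close>. Each evaluation is a finite sum over one fixed
  representative, so independent evaluations can be interchanged freely, and all products are taken
  in \<open>H\<close> itself, where associativity is automatic.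
\<close>

section \<open>Linear forms on a free vector space\<close>

interpretation free: vector_space "free_scale :: 'k::field \<Rightarrow> ('x \<Rightarrow>\<^sub>0 'k) \<Rightarrow> ('x \<Rightarrow>\<^sub>0 'k)"
  by (rule vector_space_free_scale)

definition free_lift :: "('x \<Rightarrow> 'k::field) \<Rightarrow> ('x \<Rightarrow>\<^sub>0 'k) \<Rightarrow> 'k" where
  "free_lift \<phi> f = (\<Sum>x\<in>Poly_Mapping.keys f. Poly_Mapping.lookup f x * \<phi> x)"

lemma free_lift_superset:
  assumes "finite A" "Poly_Mapping.keys f \<subseteq> A"
  shows "free_lift \<phi> f = (\<Sum>x\<in>A. Poly_Mapping.lookup f x * \<phi> x)"
  unfolding free_lift_def using assms
  by (intro sum.mono_neutral_left) (auto simp: in_keys_iff)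

lemma free_lift_add: "free_lift \<phi> (f + g) = free_lift \<phi> f + free_lift \<phi> g"
proof -
  let ?A = "Poly_Mapping.keys f \<union> Poly_Mapping.keys g"
  have "Poly_Mapping.keys (f + g) \<subseteq> ?A" by (rule Poly_Mapping.keys_add)
  then show ?thesis
    by (simp add: free_lift_superset[of ?A] lookup_add distrib_right sum.distrib)
qed

lemma free_lift_scale: "free_lift \<phi> (free_scale c f) = c * free_lift \<phi> f"
proof -
  have "Poly_Mapping.keys (free_scale c f) \<subseteq> Poly_Mapping.keys f"
    by (auto simp: in_keys_iff)
  then show ?thesis
    by (simp add: free_lift_superset[of "Poly_Mapping.keys f"] sum_distrib_left mult.assoc)
qed

lemma free_lift_zero [simp]: "free_lift \<phi> 0 = 0"
  by (simp add: free_lift_def)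

lemma free_lift_single [simp]: "free_lift \<phi> (Poly_Mapping.single x c) = c * \<phi> x"
  by (simp add: free_lift_def)

lemma free_lift_diff: "free_lift \<phi> (f - g) = free_lift \<phi> f - free_lift \<phi> g"
  using free_lift_add[of \<phi> "f - g" g] by simp

lemma free_lift_sum: "free_lift \<phi> (sum f A) = (\<Sum>x\<in>A. free_lift \<phi> (f x))"
  by (induction A rule: infinite_finite_induct) (simp_all add: free_lift_add)

lemma free_expansion:
  "f = (\<Sum>x\<in>Poly_Mapping.keys f. free_scale (Poly_Mapping.lookup f x) (Poly_Mapping.single x 1))"
proof (rule poly_mapping_eqI)
  fix k
  have "Poly_Mapping.lookup (\<Sum>x\<in>Poly_Mapping.keys f.
      free_scale (Poly_Mapping.lookup f x) (Poly_Mapping.single x 1)) k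
    = (\<Sum>x\<in>Poly_Mapping.keys f. if k = x then Poly_Mapping.lookup f x else 0)"
    unfolding lookup_sum by (rule sum.cong) (auto simp: lookup_single when_def)
  also have "\<dots> = Poly_Mapping.lookup f k"
    by (simp add: in_keys_iff)
  finally show "Poly_Mapping.lookup f k = Poly_Mapping.lookup (\<Sum>x\<in>Poly_Mapping.keys f.
      free_scale (Poly_Mapping.lookup f x) (Poly_Mapping.single x 1)) k" by simp
qed

text \<open>A basis of the span of \<open>R\<close> together with \<open>v\<close> is independent, so a linear form can be prescribed on it: zero
  on the basis, one at \<open>v\<close>.\<close>

lemma separating_functional:
  fixes v :: "'x \<Rightarrow>\<^sub>0 'k::field"
  assumes "v \<notin> free.span R"
  obtains \<phi> where "\<And>r. r \<in> R \<Longrightarrow> free_lift \<phi> r = 0" "free_lift \<phi> v = 1"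
proof -
  interpret functional: vector_space_pair "free_scale :: 'k \<Rightarrow> ('x \<Rightarrow>\<^sub>0 'k) \<Rightarrow> ('x \<Rightarrow>\<^sub>0 'k)"
    "(*) :: 'k \<Rightarrow> 'k \<Rightarrow> 'k"
    by unfold_locales (auto simp: algebra_simps)
  obtain B where B: "B \<subseteq> R" "free.independent B" "R \<subseteq> free.span B"
    using free.maximal_independent_subset .
  have v: "v \<notin> free.span B"
    using assms free.span_mono[OF B(1)] by blast
  have "free.independent (insert v B)"
    by (rule free.independent_insertI) (rule v B(2))+
  from functional.linear_independent_extend[OF this, of "\<lambda>x. if x = v then 1 else 0"]
  obtain L where L: "Vector_Spaces.linear free_scale (*) L"
    and L_basis: "\<And>x. x \<in> insert v B \<Longrightarrow> L x = (if x = v then 1 else 0)" by blast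
  have L_lift: "free_lift (\<lambda>x. L (Poly_Mapping.single x 1)) f = L f" for f
  proof -
    have "L f = L (\<Sum>x\<in>Poly_Mapping.keys f.
        free_scale (Poly_Mapping.lookup f x) (Poly_Mapping.single x 1))"
      by (rule arg_cong[OF free_expansion])
    also have "\<dots> = (\<Sum>x\<in>Poly_Mapping.keys f. Poly_Mapping.lookup f x * L (Poly_Mapping.single x 1))"
      by (simp only: functional.linear_sum[OF L] functional.linear_scale[OF L])
    finally show ?thesis by (simp only: free_lift_def)
  qed
  show thesis
  proof (rule that[of "\<lambda>x. L (Poly_Mapping.single x 1)"], unfold L_lift)
    show "L v = 1" using L_basis[of v] by simp
    show "L r = 0" if "r \<in> R" for r
    proof (rule functional.linear_eq_0_on_span[OF L])
      show "L b = 0" if "b \<in> B" for b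
        using L_basis[of b] that v free.span_base[of v B] by auto
      show "r \<in> free.span B" using B(3) that by blast
    qed
  qed
qed

section \<open>Evaluation of tensors on multilinear forms\<close>

context k_algebra
begin

definition multilinear_form :: "('h list \<Rightarrow> 'k) \<Rightarrow> bool" where
  "multilinear_form \<phi> \<longleftrightarrow>
     (\<forall>us a b vs. \<phi> (us @ (a + b) # vs) = \<phi> (us @ a # vs) + \<phi> (us @ b # vs)) \<and>
     (\<forall>us c a vs. \<phi> (us @ (c *s a) # vs) = c * \<phi> (us @ a # vs))"

text \<open>For \<open>\<phi>\<close> multilinear this is the value at \<open>t\<close> of the linear form on tensors induced by \<open>\<phi>\<close>. Fixing the
  representative even for other \<open>\<phi>\<close> makes evaluation additive in \<open>\<phi>\<close> and interchangeable with other
  evaluations without any hypothesis.\<close>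

definition pairing :: "('h list \<Rightarrow> 'k) \<Rightarrow> ('k, 'h) tensor \<Rightarrow> 'k" where
  "pairing \<phi> t = free_lift \<phi> (representative t)"

lemma free_lift_span_relations:
  assumes "multilinear_form \<phi>" "f \<in> free.span relations"
  shows "free_lift \<phi> f = 0"
proof -
  have add: "\<phi> (us @ (a + b) # vs) = \<phi> (us @ a # vs) + \<phi> (us @ b # vs)"
    and scale: "\<phi> (us @ (c *s a) # vs) = c * \<phi> (us @ a # vs)" for us a b vs c
    using assms(1) unfolding multilinear_form_def by blast+
  have rel: "free_lift \<phi> r = 0" if "r \<in> relations" for r
    using that unfolding relations_def
  proof (elim UnE CollectE exE conjE)
    fix us a b vs
    assume r: "r = Poly_Mapping.single (us @ [a + b] @ vs) 1
      - Poly_Mapping.single (us @ [a] @ vs) 1 - Poly_Mapping.single (us @ [b] @ vs) 1"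
    show ?thesis unfolding r by (simp add: free_lift_diff add)
  next
    fix us c a vs
    assume r: "r = Poly_Mapping.single (us @ [c *s a] @ vs) 1 - Poly_Mapping.single (us @ [a] @ vs) c"
    show ?thesis unfolding r by (simp add: free_lift_diff scale)
  qed
  from assms(2) show ?thesis
    by (induction rule: free.span_induct_alt) (simp_all add: rel free_lift_add free_lift_scale)
qed

lemma representative_coset: "representative (coset f) - f \<in> free.span relations"
proof -
  have "f \<in> coset f" by (simp add: coset_def free.span_zero)
  then have "representative (coset f) \<in> coset f"
    unfolding representative_def by (rule someI)
  then show ?thesis by (simp add: coset_def)
qed

lemma pairing_coset:
  assumes "multilinear_form \<phi>"
  shows "pairing \<phi> (coset f) = free_lift \<phi> f"
  using free_lift_span_relations[OF assms representative_coset[of f]]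
  by (simp add: pairing_def free_lift_diff)

text \<open>If \<open>f - g\<close> were not in the span of the relations, a linear form that vanishes on the relations and is one
  at \<open>f - g\<close> would restrict to a multilinear form on words that tells the two cosets apart.\<close>

lemma coset_eqI:
  assumes "\<And>\<phi>. multilinear_form \<phi> \<Longrightarrow> pairing \<phi> (coset f) = pairing \<phi> (coset g)"
  shows "coset f = coset g"
proof -
  have "f - g \<in> free.span relations"
  proof (rule ccontr)
    assume "f - g \<notin> free.span relations"
    then obtain \<phi> where zero: "\<And>r. r \<in> relations \<Longrightarrow> free_lift \<phi> r = 0"
      and one: "free_lift \<phi> (f - g) = 1"
      using separating_functional by blast
    have "multilinear_form \<phi>"
      unfolding multilinear_form_def
    proof (intro conjI allI)
      fix us vs and a b :: 'h
      have "Poly_Mapping.single (us @ [a + b] @ vs) 1 - Poly_Mapping.single (us @ [a] @ vs) 1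
        - Poly_Mapping.single (us @ [b] @ vs) 1 \<in> relations"
        unfolding relations_def by blast
      from zero[OF this] show "\<phi> (us @ (a + b) # vs) = \<phi> (us @ a # vs) + \<phi> (us @ b # vs)"
        by (simp add: free_lift_diff diff_eq_eq add.commute)
    next
      fix us vs c and a :: 'h
      have "Poly_Mapping.single (us @ [c *s a] @ vs) 1 - Poly_Mapping.single (us @ [a] @ vs) c
        \<in> relations"
        unfolding relations_def by blast
      from zero[OF this] show "\<phi> (us @ (c *s a) # vs) = c * \<phi> (us @ a # vs)"
        by (simp add: free_lift_diff)
    qed
    then show False
      using assms[of \<phi>] one by (simp add: pairing_coset free_lift_diff)
  qed
  then have "h - f \<in> free.span relations \<longleftrightarrow> h - g \<in> free.span relations" for h
    using free.span_add_eq[of "f - g" relations "h - f"] by simp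
  then show ?thesis by (simp add: coset_def)
qed

lemma pairing_zero [simp]: "pairing (\<lambda>xs. 0) t = 0"
  by (simp add: pairing_def free_lift_def)

lemma pairing_add: "pairing (\<lambda>xs. \<phi> xs + \<psi> xs) t = pairing \<phi> t + pairing \<psi> t"
  by (simp add: pairing_def free_lift_def distrib_left sum.distrib)

lemma pairing_scale: "pairing (\<lambda>xs. c * \<phi> xs) t = c * pairing \<phi> t"
  by (simp add: pairing_def free_lift_def sum_distrib_left mult_ac)

lemma pairing_swap:
  "pairing (\<lambda>xs. pairing (\<lambda>ys. \<phi> xs ys) t) s = pairing (\<lambda>ys. pairing (\<lambda>xs. \<phi> xs ys) s) t"
  unfolding pairing_def free_lift_def sum_distrib_left
  by (subst sum.swap) (simp add: mult_ac)

lemma pairing_pure_tensor [simp]: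
  "multilinear_form \<phi> \<Longrightarrow> pairing \<phi> (pure_tensor xs) = \<phi> xs"
  by (simp add: pure_tensor_def pairing_coset)

lemma pairing_tensor_zero [simp]: "multilinear_form \<phi> \<Longrightarrow> pairing \<phi> tensor_zero = 0"
  by (simp add: tensor_zero_def pairing_coset)

lemma pairing_tensor_add:
  "multilinear_form \<phi> \<Longrightarrow> pairing \<phi> (tensor_add s t) = pairing \<phi> s + pairing \<phi> t"
  by (simp add: tensor_add_def pairing_coset free_lift_add) (simp add: pairing_def)

lemma pairing_tensor_scale:
  "multilinear_form \<phi> \<Longrightarrow> pairing \<phi> (tensor_scale c t) = c * pairing \<phi> t"
  by (simp add: tensor_scale_def pairing_coset free_lift_scale) (simp add: pairing_def)

lemma pairing_scalar: "multilinear_form \<phi> \<Longrightarrow> pairing \<phi> (scalar c) = c * \<phi> []"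
  by (simp add: scalar_def pairing_coset)

lemma pairing_extend:
  "multilinear_form \<phi> \<Longrightarrow> pairing \<phi> (extend \<psi> t) = pairing (\<lambda>xs. pairing \<phi> (\<psi> xs)) t"
  by (simp add: extend_def pairing_coset free_lift_sum free_lift_scale)
    (simp add: pairing_def free_lift_def)

lemma multilinear_formD:
  assumes "multilinear_form \<phi>"
  shows "\<phi> (us @ (a + b) # vs) = \<phi> (us @ a # vs) + \<phi> (us @ b # vs)"
    and "\<phi> (us @ (c *s a) # vs) = c * \<phi> (us @ a # vs)"
  using assms unfolding multilinear_form_def by blast+

lemma multilinear_form_append:
  assumes "multilinear_form \<phi>"
  shows "multilinear_form (\<lambda>ys. \<phi> (xs @ ys))"
  using multilinear_formD[OF assms, of "xs @ _"]
  unfolding multilinear_form_def by (simp only: append_assoc simp_thms)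

lemma multilinear_form_rev:
  assumes "multilinear_form \<phi>"
  shows "multilinear_form (\<lambda>ys. \<phi> (rev ys))"
  using assms unfolding multilinear_form_def by simp

lemma pairing_tensor_product:
  "multilinear_form \<phi> \<Longrightarrow>
    pairing \<phi> (s \<boxtimes> t) = pairing (\<lambda>xs. pairing (\<lambda>ys. \<phi> (xs @ ys)) t) s"
  by (simp add: tensor_product_def pairing_extend)

lemma pairing_tensor_mult:
  assumes "multilinear_form \<phi>"
  shows "pairing \<phi> (s \<odot> t) =
    pairing (\<lambda>xs. pairing (\<lambda>ys. if length xs = length ys then \<phi> (map2 (*) xs ys) else 0) t) s"
  using assms by (simp add: tensor_mult_def pairing_extend if_distrib[of "pairing \<phi>"] cong: if_cong)

lemma pairing_reverse_tensor:
  "multilinear_form \<phi> \<Longrightarrow> pairing \<phi> (reverse_tensor t) = pairing (\<lambda>xs. \<phi> (rev xs)) t"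
  by (simp add: reverse_tensor_def pairing_extend)

section \<open>Forms in a fixed number of variables\<close>

definition linear_form :: "('h \<Rightarrow> 'k) \<Rightarrow> bool" where
  "linear_form f \<longleftrightarrow> (\<forall>a b. f (a + b) = f a + f b) \<and> (\<forall>c a. f (c *s a) = c * f a)"

definition bilinear_form :: "('h \<Rightarrow> 'h \<Rightarrow> 'k) \<Rightarrow> bool" where
  "bilinear_form f \<longleftrightarrow> (\<forall>b. linear_form (\<lambda>a. f a b)) \<and> (\<forall>a. linear_form (\<lambda>b. f a b))"

definition trilinear_form :: "('h \<Rightarrow> 'h \<Rightarrow> 'h \<Rightarrow> 'k) \<Rightarrow> bool" where
  "trilinear_form f \<longleftrightarrow>
     (\<forall>b c. linear_form (\<lambda>a. f a b c)) \<and> (\<forall>a. bilinear_form (\<lambda>b c. f a b c))"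

definition quadrilinear_form :: "('h \<Rightarrow> 'h \<Rightarrow> 'h \<Rightarrow> 'h \<Rightarrow> 'k) \<Rightarrow> bool" where
  "quadrilinear_form f \<longleftrightarrow>
     (\<forall>b c d. linear_form (\<lambda>a. f a b c d)) \<and> (\<forall>a. trilinear_form (\<lambda>b c d. f a b c d))"

lemmas form_defs = linear_form_def bilinear_form_def trilinear_form_def quadrilinear_form_def

text \<open>A form in \<open>n\<close> variables acts on words of length \<open>n\<close>; extending it by zero to all other words keeps it
  multilinear, so that it can be evaluated on tensors.\<close>

definition form1 :: "('h \<Rightarrow> 'k) \<Rightarrow> 'h list \<Rightarrow> 'k" where
  "form1 f xs = (case xs of [x] \<Rightarrow> f x | _ \<Rightarrow> 0)"

definition form2 :: "('h \<Rightarrow> 'h \<Rightarrow> 'k) \<Rightarrow> 'h list \<Rightarrow> 'k" where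
  "form2 f xs = (case xs of [x, y] \<Rightarrow> f x y | _ \<Rightarrow> 0)"

definition form3 :: "('h \<Rightarrow> 'h \<Rightarrow> 'h \<Rightarrow> 'k) \<Rightarrow> 'h list \<Rightarrow> 'k" where
  "form3 f xs = (case xs of [x, y, z] \<Rightarrow> f x y z | _ \<Rightarrow> 0)"

definition form4 :: "('h \<Rightarrow> 'h \<Rightarrow> 'h \<Rightarrow> 'h \<Rightarrow> 'k) \<Rightarrow> 'h list \<Rightarrow> 'k" where
  "form4 f xs = (case xs of [w, x, y, z] \<Rightarrow> f w x y z | _ \<Rightarrow> 0)"

definition "pairing2 f t = pairing (form2 f) t"
definition "pairing3 f t = pairing (form3 f) t"
definition "pairing4 f t = pairing (form4 f) t"

lemma bilinear_form_apply:
  "bilinear_form f \<Longrightarrow> linear_form (f a)" "bilinear_form f \<Longrightarrow> linear_form (\<lambda>a. f a b)"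
  by (simp_all add: bilinear_form_def)

lemma trilinear_form_apply:
  "trilinear_form f \<Longrightarrow> bilinear_form (f a)" "trilinear_form f \<Longrightarrow> bilinear_form (\<lambda>a b. f a b c)"
  by (simp_all add: trilinear_form_def bilinear_form_def)

lemma quadrilinear_form_apply: "quadrilinear_form f \<Longrightarrow> trilinear_form (f a)"
  by (simp add: quadrilinear_form_def)

text \<open>The forms on words are nested case distinctions, so their multilinearity is built up one letter at a
  time.\<close>

lemma multilinear_form_case_Nil: "multilinear_form (\<lambda>xs. case xs of [] \<Rightarrow> c | _ # _ \<Rightarrow> 0)"
  unfolding multilinear_form_def by (auto split: list.split simp: Cons_eq_append_conv)

lemma multilinear_form_case_Cons:
  assumes "\<And>x. multilinear_form (\<lambda>xs. g x xs)" "\<And>xs. linear_form (\<lambda>x. g x xs)"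
  shows "multilinear_form (\<lambda>xs. case xs of [] \<Rightarrow> 0 | x # xs \<Rightarrow> g x xs)"
  unfolding multilinear_form_def
proof (intro conjI allI)
  fix us vs a b
  show "(case us @ (a + b) # vs of [] \<Rightarrow> 0 | x # xs \<Rightarrow> g x xs)
    = (case us @ a # vs of [] \<Rightarrow> 0 | x # xs \<Rightarrow> g x xs) + (case us @ b # vs of [] \<Rightarrow> 0 | x # xs \<Rightarrow> g x xs)"
    using assms(2) by (cases us) (simp_all add: linear_form_def multilinear_formD[OF assms(1)])
next
  fix us vs c a
  show "(case us @ (c *s a) # vs of [] \<Rightarrow> 0 | x # xs \<Rightarrow> g x xs)
    = c * (case us @ a # vs of [] \<Rightarrow> 0 | x # xs \<Rightarrow> g x xs)"
    using assms(2) by (cases us) (simp_all add: linear_form_def multilinear_formD[OF assms(1)])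
qed

lemma multilinear_form1 [simp]: "linear_form f \<Longrightarrow> multilinear_form (form1 f)"
  unfolding form1_def
  by (intro multilinear_form_case_Cons multilinear_form_case_Nil)
    (auto simp: form_defs split: list.split)

lemma multilinear_form2 [simp]: "bilinear_form f \<Longrightarrow> multilinear_form (form2 f)"
  unfolding form2_def
  by (intro multilinear_form_case_Cons multilinear_form_case_Nil)
    (auto simp: form_defs split: list.split)

lemma multilinear_form3 [simp]: "trilinear_form f \<Longrightarrow> multilinear_form (form3 f)"
  unfolding form3_def
  by (intro multilinear_form_case_Cons multilinear_form_case_Nil)
    (auto simp: form_defs split: list.split)

lemma multilinear_form4 [simp]: "quadrilinear_form f \<Longrightarrow> multilinear_form (form4 f)"
  unfolding form4_def
  by (intro multilinear_form_case_Cons multilinear_form_case_Nil)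
    (auto simp: form_defs split: list.split)

lemma bilinear_form_word: "multilinear_form \<phi> \<Longrightarrow> bilinear_form (\<lambda>x y. \<phi> [x, y])"
  using multilinear_formD[of \<phi> "[]"] multilinear_formD[of \<phi> "[_]"]
  by (simp add: form_defs)

lemma trilinear_form_word: "multilinear_form \<phi> \<Longrightarrow> trilinear_form (\<lambda>x y z. \<phi> [x, y, z])"
  using multilinear_formD[of \<phi> "[]"] multilinear_formD[of \<phi> "[_]"] multilinear_formD[of \<phi> "[_, _]"]
  by (simp add: form_defs)

lemma form_Cons [simp]:
  "form2 f (x # xs) = form1 (f x) xs"
  "form3 g (x # xs) = form2 (g x) xs"
  "form4 h (x # xs) = form3 (h x) xs"
  by (simp_all add: form1_def form2_def form3_def form4_def split: list.split)

lemma form1_simps [simp]: "form1 f [] = 0" "form1 f [x] = f x" "form1 f (x # y # xs) = 0"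
  by (simp_all add: form1_def)

lemma form_snoc [simp]:
  "form2 f (xs @ [z]) = form1 (\<lambda>x. f x z) xs"
  "form3 g (xs @ [z]) = form2 (\<lambda>x y. g x y z) xs"
  "form4 h (xs @ [z]) = form3 (\<lambda>w x y. h w x y z) xs"
  by (simp_all add: form1_def form2_def form3_def form4_def split: list.split)

lemma form_append2 [simp]: "form4 h (xs @ [y, z]) = form2 (\<lambda>w x. h w x y z) xs"
  by (simp_all add: form2_def form4_def split: list.split)

lemma form_rev:
  "form2 f (rev xs) = form2 (\<lambda>x y. f y x) xs"
  "form3 g (rev xs) = form3 (\<lambda>x y z. g z y x) xs"
  by (simp_all add: form2_def form3_def split: list.split)

lemma form_eq_0:
  "length xs \<noteq> 2 \<Longrightarrow> form2 f xs = 0"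
  "length xs \<noteq> 3 \<Longrightarrow> form3 g xs = 0"
  "length xs \<noteq> 4 \<Longrightarrow> form4 h xs = 0"
  by (auto simp: form2_def form3_def form4_def split: list.split)

lemma form2_cong_length:
  "(\<And>x y. f x y = \<phi> [x, y]) \<Longrightarrow> (\<And>xs. length xs \<noteq> 2 \<Longrightarrow> \<phi> xs = 0) \<Longrightarrow> form2 f = \<phi>"
  by (rule ext) (auto simp: form2_def split: list.split)

lemma form3_cong_length:
  "(\<And>x y z. g x y z = \<phi> [x, y, z]) \<Longrightarrow> (\<And>xs. length xs \<noteq> 3 \<Longrightarrow> \<phi> xs = 0) \<Longrightarrow> form3 g = \<phi>"
  by (rule ext) (auto simp: form3_def split: list.split)

lemma form4_cong_length:
  "(\<And>w x y z. h w x y z = \<phi> [w, x, y, z]) \<Longrightarrow> (\<And>xs. length xs \<noteq> 4 \<Longrightarrow> \<phi> xs = 0)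
    \<Longrightarrow> form4 h = \<phi>"
  by (rule ext) (auto simp: form4_def split: list.split)

lemma form_zero [simp]: "form2 (\<lambda>x y. 0) = (\<lambda>xs. 0)" "form3 (\<lambda>x y z. 0) = (\<lambda>xs. 0)"
  by (auto simp: form2_def form3_def fun_eq_iff split: list.split)

lemma pairing2_zero [simp]: "pairing2 (\<lambda>x y. 0) t = 0"
  by (simp add: pairing2_def)

lemma pairing3_zero [simp]: "pairing3 (\<lambda>x y z. 0) t = 0"
  by (simp add: pairing3_def)

lemma pairing2_add: "pairing2 (\<lambda>x y. f x y + g x y) t = pairing2 f t + pairing2 g t"
  unfolding pairing2_def pairing_add[symmetric]
  by (intro arg_cong[where f = "\<lambda>\<phi>. pairing \<phi> t"] form2_cong_length) (auto simp: form_eq_0)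

lemma pairing3_add:
  "pairing3 (\<lambda>x y z. f x y z + g x y z) t = pairing3 f t + pairing3 g t"
  unfolding pairing3_def pairing_add[symmetric]
  by (intro arg_cong[where f = "\<lambda>\<phi>. pairing \<phi> t"] form3_cong_length) (auto simp: form_eq_0)

lemma pairing2_scale: "pairing2 (\<lambda>x y. c * f x y) t = c * pairing2 f t"
  unfolding pairing2_def pairing_scale[symmetric]
  by (intro arg_cong[where f = "\<lambda>\<phi>. pairing \<phi> t"] form2_cong_length) (auto simp: form_eq_0)

lemma pairing3_scale: "pairing3 (\<lambda>x y z. c * f x y z) t = c * pairing3 f t"
  unfolding pairing3_def pairing_scale[symmetric]
  by (intro arg_cong[where f = "\<lambda>\<phi>. pairing \<phi> t"] form3_cong_length) (auto simp: form_eq_0)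

lemma pairing4_add: "pairing4 (\<lambda>w x y z. f w x y z + g w x y z) t = pairing4 f t + pairing4 g t"
  unfolding pairing4_def pairing_add[symmetric]
  by (intro arg_cong[where f = "\<lambda>\<phi>. pairing \<phi> t"] form4_cong_length) (auto simp: form_eq_0)

lemma pairing4_scale: "pairing4 (\<lambda>w x y z. c * f w x y z) t = c * pairing4 f t"
  unfolding pairing4_def pairing_scale[symmetric]
  by (intro arg_cong[where f = "\<lambda>\<phi>. pairing \<phi> t"] form4_cong_length) (auto simp: form_eq_0)

lemma pairing2_cong: "(\<And>x y. f x y = g x y) \<Longrightarrow> pairing2 f t = pairing2 g t"
  by presburger

lemma pairing3_cong: "(\<And>x y z. f x y z = g x y z) \<Longrightarrow> pairing3 f t = pairing3 g t"
  by presburger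

text \<open>Multilinearity of the forms below is proved by rewriting: sums and scalars move out of products and
  evaluations up to the head of the term.\<close>

lemmas form_simps = form_defs distrib_left distrib_right scale_mult_left scale_mult_right
  pairing2_add pairing3_add pairing2_scale pairing3_scale

lemma pairing2_pairing:
  "pairing2 (\<lambda>x y. pairing (F x y) t) s = pairing (\<lambda>ys. pairing2 (\<lambda>x y. F x y ys) s) t"
proof -
  have "form2 (\<lambda>x y. pairing (F x y) t) = (\<lambda>xs. pairing (\<lambda>ys. form2 (\<lambda>x y. F x y ys) xs) t)"
    by (rule form2_cong_length) (simp_all add: form_eq_0)
  then show ?thesis unfolding pairing2_def by (simp only: pairing_swap[of _ t s])
qed

lemma pairing3_pairing:
  "pairing3 (\<lambda>x y z. pairing (F x y z) t) s = pairing (\<lambda>ys. pairing3 (\<lambda>x y z. F x y z ys) s) t"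
proof -
  have "form3 (\<lambda>x y z. pairing (F x y z) t) = (\<lambda>xs. pairing (\<lambda>ys. form3 (\<lambda>x y z. F x y z ys) xs) t)"
    by (rule form3_cong_length) (simp_all add: form_eq_0)
  then show ?thesis unfolding pairing3_def by (simp only: pairing_swap[of _ t s])
qed

lemma pairing_swap22:
  "pairing2 (\<lambda>x y. pairing2 (\<lambda>a b. F x y a b) t) s = pairing2 (\<lambda>a b. pairing2 (\<lambda>x y. F x y a b) s) t"
proof -
  have "(\<lambda>ys. pairing2 (\<lambda>x y. form2 (\<lambda>a b. F x y a b) ys) s)
    = form2 (\<lambda>a b. pairing2 (\<lambda>x y. F x y a b) s)"
    by (rule form2_cong_length[symmetric]) (simp_all add: form_eq_0)
  then show ?thesis unfolding pairing2_def[of _ t] pairing2_pairing by simp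
qed

lemma pairing_swap33:
  "pairing3 (\<lambda>x y z. pairing3 (\<lambda>a b c. F x y z a b c) t) s
    = pairing3 (\<lambda>a b c. pairing3 (\<lambda>x y z. F x y z a b c) s) t"
proof -
  have "(\<lambda>ys. pairing3 (\<lambda>x y z. form3 (\<lambda>a b c. F x y z a b c) ys) s)
    = form3 (\<lambda>a b c. pairing3 (\<lambda>x y z. F x y z a b c) s)"
    by (rule form3_cong_length[symmetric]) (simp_all add: form_eq_0)
  then show ?thesis unfolding pairing3_def[of _ t] pairing3_pairing by simp
qed

lemma pairing_swap23:
  "pairing2 (\<lambda>x y. pairing3 (\<lambda>a b c. F x y a b c) t) s
    = pairing3 (\<lambda>a b c. pairing2 (\<lambda>x y. F x y a b c) s) t"
proof -
  have "(\<lambda>ys. pairing2 (\<lambda>x y. form3 (\<lambda>a b c. F x y a b c) ys) s)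
    = form3 (\<lambda>a b c. pairing2 (\<lambda>x y. F x y a b c) s)"
    by (rule form3_cong_length[symmetric]) (simp_all add: form_eq_0)
  then show ?thesis unfolding pairing3_def[of _ t] pairing2_pairing by simp
qed

lemma pairing_rotate222:
  "pairing2 (\<lambda>x y. pairing2 (\<lambda>a b. pairing2 (\<lambda>c d. F x y a b c d) u) t) s
    = pairing2 (\<lambda>a b. pairing2 (\<lambda>c d. pairing2 (\<lambda>x y. F x y a b c d) s) u) t"
  by (subst pairing_swap22, rule pairing2_cong, rule pairing_swap22)

section \<open>Operations on tensors under evaluation\<close>

lemma pairing2_mult:
  assumes "bilinear_form f"
  shows "pairing2 f (s \<odot> t) = pairing2 (\<lambda>a b. pairing2 (\<lambda>a' b'. f (a * a') (b * b')) t) s"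
proof -
  have "(\<lambda>xs. pairing (\<lambda>ys. if length xs = length ys then form2 f (map2 (*) xs ys) else 0) t)
    = form2 (\<lambda>a b. pairing2 (\<lambda>a' b'. f (a * a') (b * b')) t)"
    unfolding pairing2_def
    by (rule form2_cong_length[symmetric],
      intro arg_cong[where f = "\<lambda>\<phi>. pairing \<phi> t"] form2_cong_length)
      (auto simp: form_eq_0 cong: if_cong)
  with assms show ?thesis by (simp add: pairing2_def pairing_tensor_mult)
qed

lemma pairing3_mult:
  assumes "trilinear_form f"
  shows "pairing3 f (s \<odot> t)
    = pairing3 (\<lambda>a b c. pairing3 (\<lambda>a' b' c'. f (a * a') (b * b') (c * c')) t) s"
proof -
  have "(\<lambda>xs. pairing (\<lambda>ys. if length xs = length ys then form3 f (map2 (*) xs ys) else 0) t)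
    = form3 (\<lambda>a b c. pairing3 (\<lambda>a' b' c'. f (a * a') (b * b') (c * c')) t)"
    unfolding pairing3_def
    by (rule form3_cong_length[symmetric],
      intro arg_cong[where f = "\<lambda>\<phi>. pairing \<phi> t"] form3_cong_length)
      (auto simp: form_eq_0 cong: if_cong)
  with assms show ?thesis by (simp add: pairing3_def pairing_tensor_mult)
qed

lemma pairing4_mult:
  assumes "quadrilinear_form f"
  shows "pairing4 f (s \<odot> t)
    = pairing4 (\<lambda>a b c d. pairing4 (\<lambda>a' b' c' d'. f (a * a') (b * b') (c * c') (d * d')) t) s"
proof -
  have "(\<lambda>xs. pairing (\<lambda>ys. if length xs = length ys then form4 f (map2 (*) xs ys) else 0) t)
    = form4 (\<lambda>a b c d. pairing4 (\<lambda>a' b' c' d'. f (a * a') (b * b') (c * c') (d * d')) t)"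
    unfolding pairing4_def
    by (rule form4_cong_length[symmetric],
      intro arg_cong[where f = "\<lambda>\<phi>. pairing \<phi> t"] form4_cong_length)
      (auto simp: form_eq_0 cong: if_cong)
  with assms show ?thesis by (simp add: pairing4_def pairing_tensor_mult)
qed

text \<open>Evaluating a tensor product on \<open>\<phi>\<close> means evaluating its first factor on the form obtained by evaluating
  the second one; for pure factors the outer evaluation collapses because that form is multilinear.\<close>

lemma multilinear_form_pairing_append:
  assumes "multilinear_form \<phi>"
  shows "multilinear_form (\<lambda>xs. pairing (\<lambda>ys. \<phi> (xs @ ys)) t)"
  using multilinear_formD[OF assms]
  by (simp add: multilinear_form_def pairing_add pairing_scale)

lemma pairing_pure_product:
  "multilinear_form \<phi> \<Longrightarrow> pairing \<phi> (pure_tensor xs \<boxtimes> t) = pairing (\<lambda>ys. \<phi> (xs @ ys)) t"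
  by (simp add: pairing_tensor_product multilinear_form_pairing_append)

lemma pairing_product_pure:
  "multilinear_form \<phi> \<Longrightarrow> pairing \<phi> (t \<boxtimes> pure_tensor ys) = pairing (\<lambda>xs. \<phi> (xs @ ys)) t"
  by (simp add: pairing_tensor_product multilinear_form_append)

lemma pairing_scalar_product:
  "multilinear_form \<phi> \<Longrightarrow> pairing \<phi> (scalar c \<boxtimes> t) = c * pairing \<phi> t"
  by (simp add: pairing_tensor_product multilinear_form_pairing_append pairing_scalar)

lemma pairing_tensor_map:
  assumes "multilinear_form \<phi>"
  shows "pairing \<phi> (tensor_map fs t) = pairing (\<lambda>xs. if length xs = length fs
    then pairing \<phi> (foldr (\<boxtimes>) (map2 (\<lambda>f x. f x) fs xs) (pure_tensor [])) else 0) t"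
  using assms by (simp add: tensor_map_def pairing_extend if_distrib[of "pairing \<phi>"] cong: if_cong)

lemma pairing2_tensor_map:
  assumes "multilinear_form \<phi>"
  shows "pairing \<phi> (tensor_map [f, g] t)
    = pairing2 (\<lambda>x y. pairing \<phi> (f x \<boxtimes> g y \<boxtimes> pure_tensor [])) t"
  unfolding pairing_tensor_map[OF assms] pairing2_def
  by (intro arg_cong[where f = "\<lambda>\<phi>. pairing \<phi> t"] form2_cong_length[symmetric]) simp_all

lemma pairing3_tensor_map:
  assumes "multilinear_form \<phi>"
  shows "pairing \<phi> (tensor_map [f, g, h] t)
    = pairing3 (\<lambda>x y z. pairing \<phi> (f x \<boxtimes> g y \<boxtimes> h z \<boxtimes> pure_tensor [])) t"
  unfolding pairing_tensor_map[OF assms] pairing3_def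
  by (intro arg_cong[where f = "\<lambda>\<phi>. pairing \<phi> t"] form3_cong_length[symmetric]) simp_all

definition is_tensor :: "('k, 'h) tensor \<Rightarrow> bool" where
  "is_tensor t \<longleftrightarrow> t \<in> range coset"

lemma is_tensor_extend [simp]: "is_tensor (extend \<psi> t)"
  by (simp add: is_tensor_def extend_def)

lemma is_tensor_pure [simp]: "is_tensor (pure_tensor xs)"
  by (simp add: is_tensor_def pure_tensor_def)

lemma is_tensor_mult [simp]: "is_tensor (s \<odot> t)"
  by (simp add: tensor_mult_def)

lemma is_tensor_power: "t \<in> tensor_power n \<Longrightarrow> is_tensor t"
  by (auto simp: is_tensor_def tensor_power_def)

lemma tensor_eqI:
  assumes "is_tensor s" "is_tensor t" "\<And>\<phi>. multilinear_form \<phi> \<Longrightarrow> pairing \<phi> s = pairing \<phi> t"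
  shows "s = t"
proof -
  obtain f g where "s = coset f" "t = coset g"
    using assms(1,2) unfolding is_tensor_def by blast
  then show ?thesis
    using assms(3) by (simp only:) (rule coset_eqI)
qed

lemma pure_tensor_product: "pure_tensor xs \<boxtimes> pure_tensor ys = pure_tensor (xs @ ys)"
proof (rule tensor_eqI)
  show "is_tensor (pure_tensor xs \<boxtimes> pure_tensor ys)" by (simp add: tensor_product_def)
qed (simp_all add: pairing_pure_product multilinear_form_append)

lemmas tensor_map_simps = \<iota>_def pure_tensor_product pairing2_tensor_map pairing3_tensor_map
  pairing_pure_product pairing_product_pure pairing_scalar_product
  pairing2_def pairing3_def pairing4_def

lemma multilinear_form_Cons: "multilinear_form \<phi> \<Longrightarrow> multilinear_form (\<lambda>ys. \<phi> (x # ys))"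
  using multilinear_form_append[of \<phi> "[x]"] by simp

lemma pairing_coproduct_id:
  "trilinear_form f \<Longrightarrow> pairing3 f (tensor_map [D, \<iota>] t)
    = pairing2 (\<lambda>a b. pairing2 (\<lambda>x y. f x y b) (D a)) t"
  by (simp add: tensor_map_simps trilinear_form_apply[of f])

lemma pairing_id_coproduct:
  "trilinear_form f \<Longrightarrow> pairing3 f (tensor_map [\<iota>, D] t)
    = pairing2 (\<lambda>a b. pairing2 (\<lambda>x y. f a x y) (D b)) t"
  by (simp add: tensor_map_simps trilinear_form_apply[of f] multilinear_form_Cons)

lemma pairing_coproduct_id_id:
  "quadrilinear_form f \<Longrightarrow> pairing4 f (tensor_map [D, \<iota>, \<iota>] t)
    = pairing3 (\<lambda>a b c. pairing2 (\<lambda>x y. f x y b c) (D a)) t"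
  by (simp add: tensor_map_simps quadrilinear_form_apply[of f] trilinear_form_apply[of "f _"])

lemma pairing_id_coproduct_id:
  "quadrilinear_form f \<Longrightarrow> pairing4 f (tensor_map [\<iota>, D, \<iota>] t)
    = pairing3 (\<lambda>a b c. pairing2 (\<lambda>x y. f a x y c) (D b)) t"
  by (simp add: tensor_map_simps quadrilinear_form_apply[of f] trilinear_form_apply[of "f _"] multilinear_form_Cons)

lemma pairing_id_id_coproduct:
  "quadrilinear_form f \<Longrightarrow> pairing4 f (tensor_map [\<iota>, \<iota>, D] t)
    = pairing3 (\<lambda>a b c. pairing2 (\<lambda>x y. f a b x y) (D c)) t"
  by (simp add: tensor_map_simps quadrilinear_form_apply[of f] trilinear_form_apply[of "f _"] multilinear_form_Cons)

lemma pairing_tensor_one_right: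
  "quadrilinear_form f \<Longrightarrow> pairing4 f (t \<boxtimes> \<iota> 1) = pairing3 (\<lambda>a b c. f a b c 1) t"
  by (simp add: tensor_map_simps quadrilinear_form_apply[of f] trilinear_form_apply[of "f _"])

lemma pairing_tensor_one_left:
  "quadrilinear_form f \<Longrightarrow> pairing4 f (\<iota> 1 \<boxtimes> t) = pairing3 (\<lambda>b c d. f 1 b c d) t"
  by (simp add: tensor_map_simps quadrilinear_form_apply[of f] trilinear_form_apply[of "f _"])

lemma pairing_counit_id:
  "linear_form f \<Longrightarrow> pairing (form1 f) (tensor_map [\<lambda>b. scalar (e b), \<iota>] t)
    = pairing2 (\<lambda>a b. e a * f b) t"
  by (simp add: tensor_map_simps multilinear_form_Cons del: pairing_product_pure)

lemma pairing_id_counit: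
  "linear_form f \<Longrightarrow> pairing (form1 f) (tensor_map [\<iota>, \<lambda>b. scalar (e b)] t)
    = pairing2 (\<lambda>a b. e b * f a) t"
  by (simp add: tensor_map_simps multilinear_form_Cons del: pairing_product_pure)

lemma pairing_id_counit_id:
  "bilinear_form f \<Longrightarrow> pairing2 f (tensor_map [\<iota>, \<lambda>b. scalar (e b), \<iota>] t)
    = pairing3 (\<lambda>a b c. e b * f a c) t"
  by (simp add: tensor_map_simps bilinear_form_apply[of f] multilinear_form_Cons del: pairing_product_pure)

lemma pairing2_map_both:
  "bilinear_form f \<Longrightarrow> pairing2 f (map_both g t) = pairing2 (\<lambda>a b. f (g a) (g b)) t"
  by (simp add: map_both_def tensor_map_simps)

lemma pairing_map_both:
  "multilinear_form \<phi> \<Longrightarrow> pairing \<phi> (map_both g t) = pairing2 (\<lambda>a b. \<phi> [g a, g b]) t"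
  by (simp add: map_both_def tensor_map_simps)

lemma pairing2_reverse_tensor:
  "bilinear_form f \<Longrightarrow> pairing2 f (reverse_tensor t) = pairing2 (\<lambda>a b. f b a) t"
  by (simp add: pairing2_def pairing_reverse_tensor form_rev)

lemma pairing3_reverse_tensor:
  "trilinear_form f \<Longrightarrow> pairing3 f (reverse_tensor t) = pairing3 (\<lambda>a b c. f c b a) t"
  by (simp add: pairing3_def pairing_reverse_tensor form_rev)

lemma pairing_tensor_one:
  "bilinear_form f \<Longrightarrow> pairing2 f (tensor_one 2) = f 1 1"
  "trilinear_form g \<Longrightarrow> pairing3 g (tensor_one 3) = g 1 1 1"
  by (simp_all add: tensor_one_def pairing2_def pairing3_def numeral_2_eq_2 numeral_3_eq_3)

section \<open>Homogeneous tensors and inverses\<close>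

text \<open>Homogeneity is expressed through evaluation, since the chosen representative of a tensor of degree
  \<open>n\<close> may contain words of other lengths, whose contributions cancel.\<close>

definition homogeneous :: "nat \<Rightarrow> ('k, 'h) tensor \<Rightarrow> bool" where
  "homogeneous n t \<longleftrightarrow> (\<forall>\<phi>. multilinear_form \<phi> \<longrightarrow>
     pairing \<phi> t = pairing (\<lambda>xs. if length xs = n then \<phi> xs else 0) t)"

lemma multilinear_form_truncate:
  "multilinear_form \<phi> \<Longrightarrow> multilinear_form (\<lambda>xs. if length xs = n then \<phi> xs else 0)"
  by (simp add: multilinear_form_def)

lemma homogeneous_tensor_power:
  assumes "t \<in> tensor_power n"
  shows "homogeneous n t"
proof -
  obtain f where t: "t = coset f" and f: "\<forall>xs\<in>Poly_Mapping.keys f. length xs = n"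
    using assms by (auto simp: tensor_power_def)
  show ?thesis
    unfolding homogeneous_def t
    using f by (simp add: pairing_coset multilinear_form_truncate free_lift_def)
qed

lemma homogeneous_pure_tensor: "length xs = n \<Longrightarrow> homogeneous n (pure_tensor xs)"
  by (simp add: homogeneous_def multilinear_form_truncate)

lemma homogeneous_reverse_tensor: "homogeneous n t \<Longrightarrow> homogeneous n (reverse_tensor t)"
  unfolding homogeneous_def
  by (simp add: pairing_reverse_tensor multilinear_form_rev multilinear_form_truncate)

lemma multilinear_form_map2_mult:
  assumes "multilinear_form \<phi>"
  shows "multilinear_form (\<lambda>ys. if length xs = length ys then \<phi> (map2 (*) xs ys) else 0)"
proof -
  have split: "\<exists>us' x vs'. xs = us' @ x # vs' \<and> length us' = length us \<and> length vs' = length vs"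
    if "length xs = Suc (length us + length vs)" for us vs :: "'h list"
    using that id_take_nth_drop[of "length us" xs]
    by (intro exI[of _ "take (length us) xs"] exI[of _ "xs ! length us"] exI[of _ "drop (Suc (length us)) xs"]) simp
  show ?thesis
    unfolding multilinear_form_def
  proof (intro conjI allI)
    fix us a b vs
    show "(if length xs = length (us @ (a + b) # vs) then \<phi> (map2 (*) xs (us @ (a + b) # vs)) else 0)
      = (if length xs = length (us @ a # vs) then \<phi> (map2 (*) xs (us @ a # vs)) else 0)
      + (if length xs = length (us @ b # vs) then \<phi> (map2 (*) xs (us @ b # vs)) else 0)"
      using split[of us vs] by (auto simp: distrib_left multilinear_formD[OF assms])
  next
    fix us c a vs
    show "(if length xs = length (us @ (c *s a) # vs) then \<phi> (map2 (*) xs (us @ (c *s a) # vs)) else 0)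
      = c * (if length xs = length (us @ a # vs) then \<phi> (map2 (*) xs (us @ a # vs)) else 0)"
      using split[of us vs] by (auto simp: scale_mult_right multilinear_formD[OF assms])
  qed
qed

text \<open>Factorwise multiplication pairs only words of equal length, so one homogeneous factor suffices.\<close>

lemma homogeneous_mult:
  assumes "homogeneous n t"
  shows "homogeneous n (s \<odot> t)"
  unfolding homogeneous_def
proof (intro allI impI)
  fix \<phi> :: "'h list \<Rightarrow> 'k" assume \<phi>: "multilinear_form \<phi>"
  have "pairing (\<lambda>ys. if length xs = length ys then \<phi> (map2 (*) xs ys) else 0) t
    = pairing (\<lambda>ys. if length xs = length ys
        then if length (map2 (*) xs ys) = n then \<phi> (map2 (*) xs ys) else 0 else 0) t" for xs
    using assms multilinear_form_map2_mult[OF \<phi>, of xs] unfolding homogeneous_def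
    by (auto intro!: arg_cong[where f = "\<lambda>\<phi>. pairing \<phi> t"])
  then show "pairing \<phi> (s \<odot> t) = pairing (\<lambda>xs. if length xs = n then \<phi> xs else 0) (s \<odot> t)"
    by (simp add: \<phi> pairing_tensor_mult multilinear_form_truncate)
qed

lemma homogeneous_extend:
  assumes "\<And>xs. homogeneous n (\<psi> xs)"
  shows "homogeneous n (extend \<psi> t)"
  using assms by (simp add: homogeneous_def pairing_extend multilinear_form_truncate)

lemma homogeneous_tensor_zero: "homogeneous n tensor_zero"
  by (simp add: homogeneous_def multilinear_form_truncate)

lemma homogeneous2_pairing:
  "homogeneous 2 t \<Longrightarrow> multilinear_form \<phi> \<Longrightarrow> pairing \<phi> t = pairing2 (\<lambda>x y. \<phi> [x, y]) t"
  unfolding homogeneous_def pairing2_def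
  by (simp add: form2_cong_length[of _ "\<lambda>xs. if length xs = 2 then \<phi> xs else 0"])

lemma homogeneous3_pairing:
  "homogeneous 3 t \<Longrightarrow> multilinear_form \<phi> \<Longrightarrow> pairing \<phi> t = pairing3 (\<lambda>x y z. \<phi> [x, y, z]) t"
  unfolding homogeneous_def pairing3_def
  by (simp add: form3_cong_length[of _ "\<lambda>xs. if length xs = 3 then \<phi> xs else 0"])

lemma tensor3_eqI:
  assumes "is_tensor s" "homogeneous 3 s" "is_tensor t" "homogeneous 3 t"
    and "\<And>f. trilinear_form f \<Longrightarrow> pairing3 f s = pairing3 f t"
  shows "s = t"
  using assms by (intro tensor_eqI) (simp_all add: homogeneous3_pairing trilinear_form_word)

lemma tensor_mult_assoc3:
  assumes "homogeneous 3 u"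
  shows "s \<odot> t \<odot> u = s \<odot> (t \<odot> u)"
proof (rule tensor3_eqI)
  fix f :: "'h \<Rightarrow> 'h \<Rightarrow> 'h \<Rightarrow> 'k" assume f: "trilinear_form f"
  have right: "trilinear_form (\<lambda>x y z. pairing3 (\<lambda>a b c. f (x * a) (y * b) (z * c)) u)"
    and left: "trilinear_form (\<lambda>x y z. f (p * x) (q * y) (r * z))" for p q r
    using f by (simp_all add: form_simps)
  show "pairing3 f (s \<odot> t \<odot> u) = pairing3 f (s \<odot> (t \<odot> u))"
    by (simp only: pairing3_mult[OF f] pairing3_mult[OF right] pairing3_mult[OF left] mult.assoc)
qed (simp_all add: homogeneous_mult assms)

lemma tensor_one_mult3:
  assumes "homogeneous 3 t" "is_tensor t"
  shows "tensor_one 3 \<odot> t = t"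
proof (rule tensor3_eqI)
  fix f :: "'h \<Rightarrow> 'h \<Rightarrow> 'h \<Rightarrow> 'k" assume f: "trilinear_form f"
  then have "trilinear_form (\<lambda>x y z. pairing3 (\<lambda>a b c. f (x * a) (y * b) (z * c)) t)"
    by (simp add: form_simps)
  then show "pairing3 f (tensor_one 3 \<odot> t) = pairing3 f t"
    by (simp add: pairing3_mult f pairing_tensor_one)
qed (simp_all add: homogeneous_mult assms)

lemma tensor_mult_one3:
  assumes "homogeneous 3 t" "is_tensor t"
  shows "t \<odot> tensor_one 3 = t"
proof (rule tensor3_eqI)
  fix f :: "'h \<Rightarrow> 'h \<Rightarrow> 'h \<Rightarrow> 'k" assume f: "trilinear_form f"
  then have "trilinear_form (\<lambda>a b c. f (x * a) (y * b) (z * c))" for x y z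
    by (simp add: form_simps)
  then show "pairing3 f (t \<odot> tensor_one 3) = pairing3 f t"
    by (simp add: pairing3_mult f pairing_tensor_one)
qed (simp_all add: homogeneous_mult homogeneous_pure_tensor assms tensor_one_def)

lemma tensor_inverse3_eq:
  assumes "is_tensor_inverse 3 t u"
  shows "tensor_inverse 3 t = u"
  unfolding tensor_inverse_def
proof (rule the_equality)
  show "is_tensor_inverse 3 t u" by (rule assms)
next
  fix v assume v: "is_tensor_inverse 3 t v"
  have hom: "homogeneous 3 u" "is_tensor u" "homogeneous 3 v" "is_tensor v"
    using assms v by (auto simp: is_tensor_inverse_def homogeneous_tensor_power is_tensor_power)
  have "v = v \<odot> (t \<odot> u)"
    using assms hom by (simp add: is_tensor_inverse_def tensor_mult_one3)
  also have "\<dots> = (v \<odot> t) \<odot> u"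
    by (rule tensor_mult_assoc3[symmetric]) (rule hom)
  also have "\<dots> = u"
    using v hom by (simp add: is_tensor_inverse_def tensor_one_mult3)
  finally show "v = u" .
qed

lemma pairing3_inverse:
  assumes "is_tensor_inverse 3 t u" "trilinear_form f"
  shows "pairing3 (\<lambda>a b c. pairing3 (\<lambda>x y z. f (a * x) (b * y) (c * z)) u) t = f 1 1 1"
    and "pairing3 (\<lambda>a b c. pairing3 (\<lambda>x y z. f (a * x) (b * y) (c * z)) t) u = f 1 1 1"
  using assms by (simp_all add: pairing3_mult[symmetric] is_tensor_inverse_def pairing_tensor_one)

text \<open>Reversing the words of a homogeneous representative of \<open>t\<close> gives a representative of the reversed
  tensor.\<close>

lemma reverse_tensor_power:
  assumes "t \<in> tensor_power n"
  shows "reverse_tensor t \<in> tensor_power n"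
proof -
  obtain f where t: "t = coset f" and f: "\<forall>xs\<in>Poly_Mapping.keys f. length xs = n"
    using assms by (auto simp: tensor_power_def)
  define g where "g = (\<Sum>xs\<in>Poly_Mapping.keys f. Poly_Mapping.single (rev xs) (Poly_Mapping.lookup f xs))"
  have "length xs = n" if xs: "xs \<in> Poly_Mapping.keys g" for xs
  proof -
    have "xs \<in> (\<Union>ys\<in>Poly_Mapping.keys f. Poly_Mapping.keys (Poly_Mapping.single (rev ys) (Poly_Mapping.lookup f ys)))"
      by (rule subsetD[OF keys_sum xs[unfolded g_def]])
    then show ?thesis using f by (auto split: if_splits)
  qed
  moreover have "reverse_tensor t = coset g"
  proof (rule tensor_eqI)
    fix \<phi> :: "'h list \<Rightarrow> 'k" assume \<phi>: "multilinear_form \<phi>"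
    then show "pairing \<phi> (reverse_tensor t) = pairing \<phi> (coset g)"
      by (simp add: pairing_reverse_tensor t pairing_coset multilinear_form_rev[OF \<phi>] g_def free_lift_sum)
        (simp add: free_lift_def)
  qed (simp add: reverse_tensor_def, simp add: is_tensor_def)
  ultimately show ?thesis by (auto simp: tensor_power_def)
qed

lemma reverse_tensor_mult3:
  assumes "homogeneous 3 t"
  shows "reverse_tensor (s \<odot> t) = reverse_tensor s \<odot> reverse_tensor t"
proof (rule tensor3_eqI)
  fix f :: "'h \<Rightarrow> 'h \<Rightarrow> 'h \<Rightarrow> 'k" assume f: "trilinear_form f"
  have "trilinear_form (\<lambda>x y z. f z y x)"
    and "\<And>a b c. trilinear_form (\<lambda>x y z. f (a * x) (b * y) (c * z))"
    and "trilinear_form (\<lambda>a b c. pairing3 (\<lambda>x y z. f (a * z) (b * y) (c * x)) t)"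
    using f by (simp_all add: form_simps)
  then show "pairing3 f (reverse_tensor (s \<odot> t)) = pairing3 f (reverse_tensor s \<odot> reverse_tensor t)"
    using f by (simp add: pairing3_reverse_tensor pairing3_mult)
qed (simp_all add: homogeneous_reverse_tensor homogeneous_mult assms, simp add: reverse_tensor_def)

lemma reverse_tensor_one3: "reverse_tensor (tensor_one 3) = tensor_one 3"
proof (rule tensor_eqI)
  fix \<phi> :: "'h list \<Rightarrow> 'k" assume \<phi>: "multilinear_form \<phi>"
  then show "pairing \<phi> (reverse_tensor (tensor_one 3)) = pairing \<phi> (tensor_one 3)"
    by (simp add: pairing_reverse_tensor tensor_one_def multilinear_form_rev[OF \<phi>])
qed (simp_all add: reverse_tensor_def tensor_one_def)

lemma reverse_tensor_inverse3:
  assumes "is_tensor_inverse 3 t u" "t \<in> tensor_power 3"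
  shows "is_tensor_inverse 3 (reverse_tensor u) (reverse_tensor t)"
proof -
  have u: "u \<in> tensor_power 3" "t \<odot> u = tensor_one 3" "u \<odot> t = tensor_one 3"
    using assms(1) by (simp_all add: is_tensor_inverse_def)
  show ?thesis
    unfolding is_tensor_inverse_def
    using u assms(2)
    by (simp only: reverse_tensor_mult3[symmetric] homogeneous_tensor_power reverse_tensor_power
        reverse_tensor_one3 simp_thms)
qed

end

section \<open>The axioms of a quasi-bialgebra under evaluation\<close>

context quasi_bialgebra
begin

abbreviation \<Psi> :: "('k, 'h) tensor" where
  "\<Psi> \<equiv> tensor_inverse 3 \<Phi>"

lemma inverse_associator: "is_tensor_inverse 3 \<Phi> \<Psi>"
  using associator_invertible tensor_inverse3_eq by blast

lemmas pairing_\<Phi>_\<Psi> = pairing3_inverse(1)[OF inverse_associator]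
  and pairing_\<Psi>_\<Phi> = pairing3_inverse(2)[OF inverse_associator]

lemma homogeneous_structure:
  "homogeneous 3 \<Phi>" "homogeneous 3 \<Psi>" "homogeneous 2 (\<Delta> a)"
  using inverse_associator associator_in_power coproduct_in_power
  by (auto simp: is_tensor_inverse_def homogeneous_tensor_power)

lemma pairing_coproduct_add:
  "bilinear_form f \<Longrightarrow> pairing2 f (\<Delta> (a + b)) = pairing2 f (\<Delta> a) + pairing2 f (\<Delta> b)"
  by (simp add: pairing2_def coproduct_add pairing_tensor_add)

lemma pairing_coproduct_scale:
  "bilinear_form f \<Longrightarrow> pairing2 f (\<Delta> (c *s a)) = c * pairing2 f (\<Delta> a)"
  by (simp add: pairing2_def coproduct_scale pairing_tensor_scale)

lemma pairing_coproduct_one: "bilinear_form f \<Longrightarrow> pairing2 f (\<Delta> 1) = f 1 1"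
  by (simp add: coproduct_one pairing_tensor_one)

lemma pairing_coproduct_mult:
  "bilinear_form f \<Longrightarrow> pairing2 f (\<Delta> (a * b))
    = pairing2 (\<lambda>a1 a2. pairing2 (\<lambda>b1 b2. f (a1 * b1) (a2 * b2)) (\<Delta> b)) (\<Delta> a)"
  by (simp add: coproduct_mult pairing2_mult)

lemma counit_simps: "\<epsilon> (a + b) = \<epsilon> a + \<epsilon> b" "\<epsilon> (c *s a) = c * \<epsilon> a"
proof -
  interpret e: Vector_Spaces.linear scale "(*)" \<epsilon> by (rule counit_linear)
  show "\<epsilon> (a + b) = \<epsilon> a + \<epsilon> b" "\<epsilon> (c *s a) = c * \<epsilon> a" by (rule e.add, rule e.scale)
qed

lemma pairing_counit_left: "linear_form f \<Longrightarrow> pairing2 (\<lambda>b c. \<epsilon> b * f c) (\<Delta> a) = f a"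
  using pairing_counit_id[of f \<epsilon> "\<Delta> a"] by (simp add: counit_left \<iota>_def)

lemma pairing_counit_right: "linear_form f \<Longrightarrow> pairing2 (\<lambda>b c. \<epsilon> c * f b) (\<Delta> a) = f a"
  using pairing_id_counit[of f \<epsilon> "\<Delta> a"] by (simp add: counit_right \<iota>_def)

lemma pairing_counit_middle: "bilinear_form f \<Longrightarrow> pairing3 (\<lambda>x y z. \<epsilon> y * f x z) \<Phi> = f 1 1"
  using pairing_id_counit_id[of f \<epsilon> \<Phi>] by (simp add: counit_associator pairing_tensor_one)

lemmas qb_form_simps = form_simps pairing_coproduct_add pairing_coproduct_scale counit_simps counit_mult

lemma associator_coproduct:
  "\<Phi> \<odot> tensor_map [\<iota>, \<Delta>] (\<Delta> a) = tensor_map [\<Delta>, \<iota>] (\<Delta> a) \<odot> \<Phi>"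
proof -
  let ?M = "tensor_map [\<Delta>, \<iota>] (\<Delta> a)"
  have hom: "homogeneous 3 (?M \<odot> \<Phi>)" by (intro homogeneous_mult homogeneous_structure)
  have "\<Phi> \<odot> tensor_map [\<iota>, \<Delta>] (\<Delta> a) = \<Phi> \<odot> (\<Psi> \<odot> (?M \<odot> \<Phi>))"
    by (simp add: quasi_coassociative tensor_mult_assoc3 homogeneous_structure)
  also have "\<dots> = (\<Phi> \<odot> \<Psi>) \<odot> (?M \<odot> \<Phi>)"
    by (rule tensor_mult_assoc3[symmetric]) (rule hom)
  also have "\<dots> = ?M \<odot> \<Phi>"
    using inverse_associator hom by (simp add: is_tensor_inverse_def tensor_one_mult3)
  finally show ?thesis .
qed

lemma pairing_quasi_coassociative:
  assumes f: "trilinear_form f"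
  shows "pairing3 (\<lambda>X Y Z. pairing2 (\<lambda>a1 a2. pairing2 (\<lambda>b c. f (X * a1) (Y * b) (Z * c)) (\<Delta> a2)) (\<Delta> a)) \<Phi>
    = pairing2 (\<lambda>a1 a2. pairing2 (\<lambda>b c. pairing3 (\<lambda>X Y Z. f (b * X) (c * Y) (a2 * Z)) \<Phi>) (\<Delta> a1)) (\<Delta> a)"
proof -
  have "trilinear_form (\<lambda>x y z. f (p * x) (q * y) (r * z))"
    "trilinear_form (\<lambda>x y z. pairing3 (\<lambda>X Y Z. f (x * X) (y * Y) (z * Z)) \<Phi>)" for p q r
    using f by (simp_all add: form_simps)
  then show ?thesis
    using arg_cong[OF associator_coproduct[of a], of "pairing3 f"] f
    by (simp add: pairing3_mult pairing_coproduct_id pairing_id_coproduct)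
qed

lemma pairing_quasi_coassociative_inverse:
  assumes f: "trilinear_form f"
  shows "pairing3 (\<lambda>X Y Z. pairing2 (\<lambda>a1 a2. pairing2 (\<lambda>b c. f (X * b) (Y * c) (Z * a2)) (\<Delta> a1)) (\<Delta> a)) \<Psi>
    = pairing2 (\<lambda>a1 a2. pairing2 (\<lambda>b c. pairing3 (\<lambda>X Y Z. f (a1 * X) (b * Y) (c * Z)) \<Psi>) (\<Delta> a2)) (\<Delta> a)"
proof -
  let ?M = "tensor_map [\<Delta>, \<iota>] (\<Delta> a)"
  have lin: "trilinear_form (\<lambda>x y z. f (p * x) (q * y) (r * z))"
    and lin': "trilinear_form (\<lambda>x y z. pairing3 (\<lambda>X Y Z. f (x * X) (y * Y) (z * Z)) \<Psi>)" for p q r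
    using f by (simp_all add: form_simps)
  have "tensor_map [\<iota>, \<Delta>] (\<Delta> a) \<odot> \<Psi> = \<Psi> \<odot> (?M \<odot> (\<Phi> \<odot> \<Psi>))"
    by (simp add: quasi_coassociative tensor_mult_assoc3 homogeneous_structure homogeneous_mult)
  also have "\<Phi> \<odot> \<Psi> = tensor_one 3"
    using inverse_associator by (simp add: is_tensor_inverse_def)
  finally have "pairing3 f (tensor_map [\<iota>, \<Delta>] (\<Delta> a) \<odot> \<Psi>) = pairing3 f (\<Psi> \<odot> (?M \<odot> tensor_one 3))"
    by (rule arg_cong)
  with lin lin' f show ?thesis
    by (simp add: pairing3_mult pairing_coproduct_id pairing_id_coproduct pairing_tensor_one
      mult.assoc[symmetric] lin[of "_ * _" "_ * _" "_ * _"])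
qed

lemma pairing_pentagon:
  assumes f: "quadrilinear_form f"
  shows "pairing3 (\<lambda>X Y Z. pairing2 (\<lambda>x1 x2. pairing3 (\<lambda>X' Y' Z'. pairing2 (\<lambda>z1 z2.
      f (x1 * X') (x2 * Y') (Y * z1) (Z * z2)) (\<Delta> Z')) \<Phi>) (\<Delta> X)) \<Phi>
    = pairing3 (\<lambda>X Y Z. pairing3 (\<lambda>X' Y' Z'. pairing2 (\<lambda>y1 y2. pairing3 (\<lambda>X'' Y'' Z''.
      f (X * X') (Y * y1 * X'') (Z * y2 * Y'') (Z' * Z'')) \<Phi>) (\<Delta> Y')) \<Phi>) \<Phi>"
proof -
  let ?A = "tensor_map [\<iota>, \<iota>, \<Delta>] \<Phi>" and ?B = "tensor_map [\<iota>, \<Delta>, \<iota>] \<Phi>" and ?C = "\<iota> 1 \<boxtimes> \<Phi>"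
  note lin = f[unfolded form_defs, simplified]
  have lin1: "quadrilinear_form (\<lambda>a b c d. f (p * a) (q * b) (r * c) (s * d))" for p q r s
    by (simp add: form_simps lin)
  have lin2: "quadrilinear_form (\<lambda>a b c d. pairing3 (\<lambda>X Y Z. pairing2 (\<lambda>z1 z2.
      f (a * X) (b * Y) (c * z1) (d * z2)) (\<Delta> Z)) \<Phi>)"
    by (simp add: form_simps lin)
  have lin3: "quadrilinear_form (\<lambda>a b c d. pairing3 (\<lambda>X Y Z. f a (b * X) (c * Y) (d * Z)) \<Phi>)"
    by (simp add: form_simps lin)
  have lin4: "quadrilinear_form (\<lambda>a b c d. pairing3 (\<lambda>X Y Z. f (p * a) (q * b * X) (r * c * Y) (s * d * Z)) \<Phi>)" for p q r s
    by (simp add: form_simps lin)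
  have lin5: "quadrilinear_form (\<lambda>a b c d. pairing3 (\<lambda>X' Y' Z'. pairing2 (\<lambda>y1 y2.
      pairing3 (\<lambda>X Y Z. f (a * X') (b * y1 * X) (c * y2 * Y) (d * Z' * Z)) \<Phi>) (\<Delta> Y')) \<Phi>)"
    by (simp add: form_simps lin)
  have "pairing4 f (tensor_map [\<Delta>, \<iota>, \<iota>] \<Phi> \<odot> ?A) = pairing4 f ((\<Phi> \<boxtimes> \<iota> 1) \<odot> ?B \<odot> ?C)"
    by (simp only: pentagon)
  then show ?thesis
    using f lin1 lin2 lin3 lin4 lin5
    by (simp add: pairing4_mult pairing_coproduct_id_id pairing_id_id_coproduct pairing_id_coproduct_id
      pairing_tensor_one_right pairing_tensor_one_left)
qed

text \<open>The pentagon multiplied on the right by \<open>1 \<otimes> \<Phi>\<^sup>-\<^sup>1\<close>, that is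
  \<open>(\<Phi> \<otimes> 1) (1 \<otimes> \<Delta> \<otimes> 1)\<Phi> = (\<Delta> \<otimes> 1 \<otimes> 1)\<Phi> (1 \<otimes> 1 \<otimes> \<Delta>)\<Phi> (1 \<otimes> \<Phi>\<^sup>-\<^sup>1)\<close>. Multiplying by a tensor on one side amounts to
  evaluating the pentagon on a form that already contains the additional factor.\<close>

lemma pairing_pentagon_right:
  assumes g: "quadrilinear_form g"
  shows "pairing3 (\<lambda>X Y Z. pairing3 (\<lambda>X' Y' Z'. pairing2 (\<lambda>y1 y2.
      g (X * X') (Y * y1) (Z * y2) Z') (\<Delta> Y')) \<Phi>) \<Phi>
    = pairing3 (\<lambda>X Y Z. pairing2 (\<lambda>x1 x2. pairing3 (\<lambda>X' Y' Z'. pairing2 (\<lambda>z1 z2. pairing3 (\<lambda>U V W.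
      g (x1 * X') (x2 * Y' * U) (Y * z1 * V) (Z * z2 * W)) \<Psi>) (\<Delta> Z')) \<Phi>) (\<Delta> X)) \<Phi>"
proof -
  note lin = g[unfolded form_defs, simplified]
  have "quadrilinear_form (\<lambda>a b c d. pairing3 (\<lambda>U V W. g a (b * U) (c * V) (d * W)) \<Psi>)"
    by (simp add: form_simps lin)
  note pentagon = pairing_pentagon[OF this]
  have collapse: "pairing3 (\<lambda>X'' Y'' Z''. pairing3 (\<lambda>U V W.
      g a (b * X'' * U) (c * Y'' * V) (d * Z'' * W)) \<Psi>) \<Phi> = g a b c d" for a b c d
  proof -
    have "trilinear_form (\<lambda>u v w. g a (b * u) (c * v) (d * w))"
      by (simp add: form_simps lin)
    from pairing_\<Phi>_\<Psi>[OF this] show ?thesis by (simp add: mult.assoc)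
  qed
  show ?thesis
    by (rule trans[OF _ pentagon[symmetric]]) (simp only: collapse)
qed

text \<open>The pentagon multiplied by inverses on both sides, that is
  \<open>(\<Phi>\<^sup>-\<^sup>1 \<otimes> 1) (\<Delta> \<otimes> 1 \<otimes> 1)\<Phi> = (1 \<otimes> \<Delta> \<otimes> 1)\<Phi> (1 \<otimes> \<Phi>) (1 \<otimes> 1 \<otimes> \<Delta>)\<Phi>\<^sup>-\<^sup>1\<close>. The two sides are the two four-fold tensors
  from which \<open>\<gamma>\<close> can be computed.\<close>

lemma pairing_pentagon_left:
  assumes g: "quadrilinear_form g"
  shows "pairing3 (\<lambda>U V W. pairing3 (\<lambda>X Y Z. pairing2 (\<lambda>x1 x2.
      g (U * x1) (V * x2) (W * Y) Z) (\<Delta> X)) \<Phi>) \<Psi>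
    = pairing3 (\<lambda>X Y Z. pairing2 (\<lambda>y1 y2. pairing3 (\<lambda>X' Y' Z'. pairing3 (\<lambda>U V W. pairing2 (\<lambda>w1 w2.
      g (X * U) (y1 * X' * V) (y2 * Y' * w1) (Z * Z' * w2)) (\<Delta> W)) \<Psi>) \<Phi>) (\<Delta> Y)) \<Phi>"
proof -
  note lin = g[unfolded form_defs, simplified]
  have "quadrilinear_form (\<lambda>a b c d. pairing3 (\<lambda>P Q R. pairing3 (\<lambda>U V W. pairing2 (\<lambda>w1 w2.
      g (P * a * U) (Q * b * V) (R * c * w1) (d * w2)) (\<Delta> W)) \<Psi>) \<Psi>)"
    by (simp add: form_simps lin)
  note pentagon = pairing_pentagon[OF this]
  \<comment> \<open>\<open>(1 \<otimes> 1 \<otimes> \<Delta>)\<Phi>\<close> is cancelled by \<open>(1 \<otimes> 1 \<otimes> \<Delta>)\<Phi>\<^sup>-\<^sup>1\<close>, because \<open>\<Delta>\<close> is multiplicative.\<close>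
  have collapse1: "pairing3 (\<lambda>X' Y' Z'. pairing2 (\<lambda>z1 z2. pairing3 (\<lambda>U V W. pairing2 (\<lambda>w1 w2.
      g (a * X' * U) (b * Y' * V) (c * z1 * w1) (d * z2 * w2)) (\<Delta> W)) \<Psi>) (\<Delta> Z')) \<Phi> = g a b c d"
    for a b c d
  proof -
    have bil: "bilinear_form (\<lambda>w1 w2. g u v (c * w1) (d * w2))" for u v
      by (simp add: form_simps lin)
    have "trilinear_form (\<lambda>u v w. pairing2 (\<lambda>w1 w2. g (a * u) (b * v) (c * w1) (d * w2)) (\<Delta> w))"
      by (simp add: qb_form_simps lin)
    from pairing_\<Phi>_\<Psi>[OF this] show ?thesis
      by (simp add: pairing_coproduct_mult[OF bil] pairing_coproduct_one[OF bil] mult.assoc pairing_swap23)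
  qed
  have inner: "pairing3 (\<lambda>X' Y' Z'. pairing2 (\<lambda>z1 z2. pairing3 (\<lambda>P Q R. pairing3 (\<lambda>U V W.
      pairing2 (\<lambda>w1 w2. g (P * (x1 * X') * U) (Q * (x2 * Y') * V) (R * (Y * z1) * w1) (Z * z2 * w2))
      (\<Delta> W)) \<Psi>) \<Psi>) (\<Delta> Z')) \<Phi> = pairing3 (\<lambda>P Q R. g (P * x1) (Q * x2) (R * Y) Z) \<Psi>"
    for x1 x2 Y Z
  proof (subst pairing_swap23, subst pairing_swap33, rule pairing3_cong)
    fix P Q R
    show "pairing3 (\<lambda>X' Y' Z'. pairing2 (\<lambda>z1 z2. pairing3 (\<lambda>U V W.
        pairing2 (\<lambda>w1 w2. g (P * (x1 * X') * U) (Q * (x2 * Y') * V) (R * (Y * z1) * w1) (Z * z2 * w2))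
        (\<Delta> W)) \<Psi>) (\<Delta> Z')) \<Phi> = g (P * x1) (Q * x2) (R * Y) Z"
      using collapse1[of "P * x1" "Q * x2" "R * Y" Z] by (simp only: mult.assoc)
  qed
  have expand: "pairing3 (\<lambda>U V W. pairing3 (\<lambda>X Y Z. pairing2 (\<lambda>x1 x2.
      g (U * x1) (V * x2) (W * Y) Z) (\<Delta> X)) \<Phi>) \<Psi>
    = pairing3 (\<lambda>X Y Z. pairing2 (\<lambda>x1 x2. pairing3 (\<lambda>P Q R.
      g (P * x1) (Q * x2) (R * Y) Z) \<Psi>) (\<Delta> X)) \<Phi>"
    by (simp only: pairing_swap23 pairing_swap33[of _ \<Psi> \<Phi>])
  have insert: "pairing3 (\<lambda>X Y Z. pairing2 (\<lambda>x1 x2. pairing3 (\<lambda>X' Y' Z'. pairing2 (\<lambda>z1 z2.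
      pairing3 (\<lambda>P Q R. pairing3 (\<lambda>U V W. pairing2 (\<lambda>w1 w2.
      g (P * (x1 * X') * U) (Q * (x2 * Y') * V) (R * (Y * z1) * w1) (Z * z2 * w2)) (\<Delta> W)) \<Psi>) \<Psi>)
      (\<Delta> Z')) \<Phi>) (\<Delta> X)) \<Phi>
    = pairing3 (\<lambda>X Y Z. pairing2 (\<lambda>x1 x2. pairing3 (\<lambda>P Q R.
      g (P * x1) (Q * x2) (R * Y) Z) \<Psi>) (\<Delta> X)) \<Phi>"
    by (simp only: inner)
  \<comment> \<open>On the other side of the pentagon \<open>\<Phi>\<^sup>-\<^sup>1 \<otimes> 1\<close> cancels \<open>\<Phi> \<otimes> 1\<close>.\<close>
  have cancel: "pairing3 (\<lambda>X Y Z. pairing3 (\<lambda>X' Y' Z'. pairing2 (\<lambda>y1 y2. pairing3 (\<lambda>X'' Y'' Z''.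
      pairing3 (\<lambda>P Q R. pairing3 (\<lambda>U V W. pairing2 (\<lambda>w1 w2.
      g (P * (X * X') * U) (Q * (Y * y1 * X'') * V) (R * (Z * y2 * Y'') * w1) (Z' * Z'' * w2))
      (\<Delta> W)) \<Psi>) \<Psi>) \<Phi>) (\<Delta> Y')) \<Phi>) \<Phi>
    = pairing3 (\<lambda>X Y Z. pairing2 (\<lambda>y1 y2. pairing3 (\<lambda>X' Y' Z'. pairing3 (\<lambda>U V W. pairing2 (\<lambda>w1 w2.
      g (X * U) (y1 * X' * V) (y2 * Y' * w1) (Z * Z' * w2)) (\<Delta> W)) \<Psi>) \<Phi>) (\<Delta> Y)) \<Phi>"
  proof -
    have "trilinear_form (\<lambda>p q r. pairing3 (\<lambda>X Y Z. pairing2 (\<lambda>y1 y2. pairing3 (\<lambda>X' Y' Z'.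
        pairing3 (\<lambda>U V W. pairing2 (\<lambda>w1 w2.
        g (p * X * U) (q * y1 * X' * V) (r * y2 * Y' * w1) (Z * Z' * w2)) (\<Delta> W)) \<Psi>) \<Phi>) (\<Delta> Y)) \<Phi>)"
      by (simp add: form_simps lin)
    from pairing_\<Psi>_\<Phi>[OF this] show ?thesis
      by (simp only: pairing_swap23 pairing_swap33[of _ \<Psi> \<Phi>] mult.assoc mult_1)
  qed
  show ?thesis
    by (rule trans[OF expand trans[OF insert[symmetric] trans[OF pentagon cancel]]])
qed

text \<open>Applying \<open>\<epsilon>\<close> to the second factor of the pentagon gives \<open>\<Phi> = \<Phi> \<cdot> (1 \<otimes> (\<epsilon> \<otimes> 1 \<otimes> 1)\<Phi>)\<close>, and \<open>\<Phi>\<close> can be cancelled.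
  The form \<open>g\<close> below contains the factor \<open>\<Phi>\<^sup>-\<^sup>1\<close> needed for the cancellation, followed by \<open>\<epsilon>\<close> in the first
  factor.\<close>

lemma pairing_counit_associator_left:
  assumes f: "bilinear_form f"
  shows "pairing3 (\<lambda>X Y Z. \<epsilon> X * f Y Z) \<Phi> = f 1 1"
proof -
  note lin = f[unfolded form_defs, simplified]
  define g where "g x y z = pairing3 (\<lambda>P Q R. \<epsilon> (P * x) * f (Q * y) (R * z)) \<Psi>" for x y z
  have "trilinear_form g"
    by (simp add: qb_form_simps lin g_def algebra_simps)
  note glin = this[unfolded form_defs, simplified]
  have ef: "trilinear_form (\<lambda>x y z. \<epsilon> x * f (y * q) (z * r))" for q r
    by (simp add: qb_form_simps lin algebra_simps)
  have g\<Phi>: "pairing3 (\<lambda>X Y Z. g X (Y * q) (Z * r)) \<Phi> = f q r" for q r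
    using pairing_\<Psi>_\<Phi>[OF ef[of q r]]
    by (simp add: g_def pairing_swap33[of _ \<Psi> \<Phi>] mult.assoc counit_one)
  have "quadrilinear_form (\<lambda>a b c d. \<epsilon> b * g a c d)"
    by (simp add: qb_form_simps glin algebra_simps)
  note pentagon = pairing_pentagon[OF this]
  have "f 1 1 = pairing3 (\<lambda>X Y Z. g X Y Z) \<Phi>"
    using g\<Phi>[of 1 1] by simp
  also have "\<dots> = pairing3 (\<lambda>X Y Z. pairing2 (\<lambda>x1 x2. \<epsilon> x2 * g x1 Y Z) (\<Delta> X)) \<Phi>"
    by (intro pairing3_cong pairing_counit_right[symmetric]) (simp add: form_simps glin)
  also have "\<dots> = pairing3 (\<lambda>X Y Z. pairing2 (\<lambda>x1 x2. pairing3 (\<lambda>X' Y' Z'. pairing2 (\<lambda>z1 z2.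
      \<epsilon> (x2 * Y') * g (x1 * X') (Y * z1) (Z * z2)) (\<Delta> Z')) \<Phi>) (\<Delta> X)) \<Phi>"
  proof (intro pairing3_cong pairing2_cong)
    fix Y Z x1 x2
    have bil: "bilinear_form (\<lambda>z1 z2. g x (Y * z1) (Z * z2))" for x
      by (simp add: form_simps glin)
    have "bilinear_form (\<lambda>x z. pairing2 (\<lambda>z1 z2. g (x1 * x) (Y * z1) (Z * z2)) (\<Delta> z))"
      by (simp add: qb_form_simps glin)
    from pairing_counit_middle[OF this]
    show "\<epsilon> x2 * g x1 Y Z = pairing3 (\<lambda>X' Y' Z'. pairing2 (\<lambda>z1 z2.
        \<epsilon> (x2 * Y') * g (x1 * X') (Y * z1) (Z * z2)) (\<Delta> Z')) \<Phi>"
      by (simp add: counit_mult mult.assoc pairing2_scale pairing3_scale pairing_coproduct_one[OF bil])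
  qed
  also note pentagon
  also have "pairing3 (\<lambda>X Y Z. pairing3 (\<lambda>X' Y' Z'. pairing2 (\<lambda>y1 y2. pairing3 (\<lambda>X'' Y'' Z''.
      \<epsilon> (Y * y1 * X'') * g (X * X') (Z * y2 * Y'') (Z' * Z'')) \<Phi>) (\<Delta> Y')) \<Phi>) \<Phi>
    = pairing3 (\<lambda>X' Y' Z'. pairing2 (\<lambda>y1 y2. \<epsilon> y1 * pairing3 (\<lambda>X'' Y'' Z''.
      \<epsilon> X'' * g X' (y2 * Y'') (Z' * Z'')) \<Phi>) (\<Delta> Y')) \<Phi>"
  proof -
    have "bilinear_form (\<lambda>X Z. pairing3 (\<lambda>X' Y' Z'. pairing2 (\<lambda>y1 y2. pairing3 (\<lambda>X'' Y'' Z''.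
        \<epsilon> y1 * (\<epsilon> X'' * g (X * X') (Z * y2 * Y'') (Z' * Z''))) \<Phi>) (\<Delta> Y')) \<Phi>)"
      by (simp add: qb_form_simps glin algebra_simps)
    from pairing_counit_middle[OF this] show ?thesis
      by (simp add: counit_mult mult.assoc flip: pairing2_scale pairing3_scale)
  qed
  also have "\<dots> = pairing3 (\<lambda>X' Y' Z'. pairing3 (\<lambda>X'' Y'' Z''.
      \<epsilon> X'' * g X' (Y' * Y'') (Z' * Z'')) \<Phi>) \<Phi>"
    by (intro pairing3_cong pairing_counit_left) (simp add: qb_form_simps glin algebra_simps)
  also have "\<dots> = pairing3 (\<lambda>X'' Y'' Z''. \<epsilon> X'' * f Y'' Z'') \<Phi>"
    by (subst pairing_swap33) (simp add: pairing3_scale g\<Phi>)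
  finally show ?thesis ..
qed

text \<open>Dually, applying \<open>\<epsilon>\<close> to the third factor of the pentagon gives \<open>\<Phi> = ((1 \<otimes> 1 \<otimes> \<epsilon>)\<Phi> \<otimes> 1) \<cdot> \<Phi>\<close>.\<close>

lemma pairing_counit_associator_right:
  assumes f: "bilinear_form f"
  shows "pairing3 (\<lambda>X Y Z. \<epsilon> Z * f X Y) \<Phi> = f 1 1"
proof -
  note lin = f[unfolded form_defs, simplified]
  define g where "g x y z = pairing3 (\<lambda>P Q R. \<epsilon> (z * R) * f (x * P) (y * Q)) \<Psi>" for x y z
  have "trilinear_form g"
    by (simp add: qb_form_simps lin g_def algebra_simps)
  note glin = this[unfolded form_defs, simplified]
  have ef: "trilinear_form (\<lambda>x y z. \<epsilon> z * f (p * x) (q * y))" for p q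
    by (simp add: qb_form_simps lin algebra_simps)
  have g\<Phi>: "pairing3 (\<lambda>X Y Z. g (p * X) (q * Y) Z) \<Phi> = f p q" for p q
    using pairing_\<Phi>_\<Psi>[OF ef[of p q]] by (simp add: g_def mult.assoc counit_one)
  have "quadrilinear_form (\<lambda>a b c d. \<epsilon> c * g a b d)"
    by (simp add: qb_form_simps glin algebra_simps)
  note pentagon = pairing_pentagon[OF this]
  have "f 1 1 = pairing3 (\<lambda>X Y Z. g X Y Z) \<Phi>"
    using g\<Phi>[of 1 1] by simp
  also have "\<dots> = pairing3 (\<lambda>X Y Z. \<epsilon> Y * pairing2 (\<lambda>x1 x2. pairing3 (\<lambda>X' Y' Z'.
      g (x1 * X') (x2 * Y') (Z * Z')) \<Phi>) (\<Delta> X)) \<Phi>"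
  proof -
    have bil: "bilinear_form (\<lambda>x1 x2. pairing3 (\<lambda>X' Y' Z'. g (x1 * X') (x2 * Y') (Z * Z')) \<Phi>)" for Z
      by (simp add: form_simps glin)
    have "bilinear_form (\<lambda>X Z. pairing2 (\<lambda>x1 x2. pairing3 (\<lambda>X' Y' Z'.
      g (x1 * X') (x2 * Y') (Z * Z')) \<Phi>) (\<Delta> X))"
      by (simp add: qb_form_simps glin)
    from pairing_counit_middle[OF this] show ?thesis
      by (simp only: pairing_coproduct_one[OF bil[of 1, unfolded mult_1_left]] mult_1_left)
  qed
  also have "\<dots> = pairing3 (\<lambda>X Y Z. pairing2 (\<lambda>x1 x2. pairing3 (\<lambda>X' Y' Z'. pairing2 (\<lambda>z1 z2.
      \<epsilon> (Y * z1) * g (x1 * X') (x2 * Y') (Z * z2)) (\<Delta> Z')) \<Phi>) (\<Delta> X)) \<Phi>"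
  proof -
    have "linear_form (\<lambda>z. g x y (Z * z))" for x y Z
      by (simp add: form_simps glin)
    from pairing_counit_left[OF this] show ?thesis
      by (simp add: counit_mult mult.assoc pairing2_scale pairing3_scale)
  qed
  also note pentagon
  also have "pairing3 (\<lambda>X Y Z. pairing3 (\<lambda>X' Y' Z'. pairing2 (\<lambda>y1 y2. pairing3 (\<lambda>X'' Y'' Z''.
      \<epsilon> (Z * y2 * Y'') * g (X * X') (Y * y1 * X'') (Z' * Z'')) \<Phi>) (\<Delta> Y')) \<Phi>) \<Phi>
    = pairing3 (\<lambda>X Y Z. \<epsilon> Z * pairing3 (\<lambda>X' Y' Z'. pairing2 (\<lambda>y1 y2.
      \<epsilon> y2 * g (X * X') (Y * y1) Z') (\<Delta> Y')) \<Phi>) \<Phi>"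
  proof -
    have "bilinear_form (\<lambda>x z. g (X * X') (Y * (y1 * x)) (Z' * z))" for X X' Y y1 Z'
      by (simp add: form_simps glin)
    from pairing_counit_middle[OF this] show ?thesis
      by (simp add: counit_mult mult.assoc pairing2_scale pairing3_scale)
  qed
  also have "\<dots> = pairing3 (\<lambda>X Y Z. \<epsilon> Z * pairing3 (\<lambda>X' Y' Z'. g (X * X') (Y * Y') Z') \<Phi>) \<Phi>"
  proof -
    have "linear_form (\<lambda>y. g x (Y * y) z)" for x Y z
      by (simp add: form_simps glin)
    from pairing_counit_right[OF this] show ?thesis by simp
  qed
  also have "\<dots> = pairing3 (\<lambda>X Y Z. \<epsilon> Z * f X Y) \<Phi>"
    by (simp add: g\<Phi>)
  finally show ?thesis ..
qed

end

section \<open>The antipode and invariant bilinear forms\<close>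

context quasi_hopf_algebra
begin

lemma antipode_simps: "S (a + b) = S a + S b" "S (c *s a) = c *s S a"
proof -
  interpret s: Vector_Spaces.linear scale scale S by (rule antipode_linear)
  show "S (a + b) = S a + S b" "S (c *s a) = c *s S a" by (rule s.add, rule s.scale)
qed

lemmas qh_form_simps = qb_form_simps antipode_simps antipode_mult

lemma linear_form_contract:
  assumes "linear_form f"
  shows "f (contract \<phi> t) = pairing (\<lambda>xs. f (\<phi> xs)) t"
proof -
  have f: "f (a + b) = f a + f b" "f (c *s a) = c * f a" for a b c
    using assms by (simp_all add: linear_form_def)
  have "f 0 = 0" using f(2)[of 0 0] by simp
  then have "f (sum h A) = (\<Sum>x\<in>A. f (h x))" for h and A :: "'h list set"
    by (induction A rule: infinite_finite_induct) (simp_all add: f)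
  then show ?thesis
    by (simp add: contract_def pairing_def free_lift_def f)
qed

lemma linear_form_contract2:
  assumes "linear_form f"
  shows "f (contract (\<lambda>xs. case xs of [x, y] \<Rightarrow> \<phi> x y | _ \<Rightarrow> 0) t) = pairing2 (\<lambda>x y. f (\<phi> x y)) t"
proof -
  have "f 0 = 0" using assms unfolding linear_form_def by (metis mult_zero_left scale_zero_left)
  then have "form2 (\<lambda>x y. f (\<phi> x y)) = (\<lambda>xs. f (case xs of [x, y] \<Rightarrow> \<phi> x y | _ \<Rightarrow> 0))"
    by (intro form2_cong_length) (auto split: list.split)
  then show ?thesis by (simp add: linear_form_contract[OF assms] pairing2_def)
qed

lemma linear_form_contract3:
  assumes "linear_form f"
  shows "f (contract (\<lambda>xs. case xs of [x, y, z] \<Rightarrow> \<phi> x y z | _ \<Rightarrow> 0) t)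
    = pairing3 (\<lambda>x y z. f (\<phi> x y z)) t"
proof -
  have "f 0 = 0" using assms unfolding linear_form_def by (metis mult_zero_left scale_zero_left)
  then have "form3 (\<lambda>x y z. f (\<phi> x y z)) = (\<lambda>xs. f (case xs of [x, y, z] \<Rightarrow> \<phi> x y z | _ \<Rightarrow> 0))"
    by (intro form3_cong_length) (auto split: list.split)
  then show ?thesis by (simp add: linear_form_contract[OF assms] pairing3_def)
qed

lemma pairing_antipode_left:
  assumes "linear_form f"
  shows "pairing2 (\<lambda>x y. f (S x * \<alpha> * y)) (\<Delta> a) = \<epsilon> a * f \<alpha>"
  unfolding linear_form_contract2[OF assms, symmetric] antipode_left
  using assms by (simp add: linear_form_def)

lemma pairing_antipode_right:
  assumes "linear_form f"
  shows "pairing2 (\<lambda>x y. f (x * \<beta> * S y)) (\<Delta> a) = \<epsilon> a * f \<beta>"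
  unfolding linear_form_contract2[OF assms, symmetric] antipode_right
  using assms by (simp add: linear_form_def)

lemma pairing_antipode_associator_inverse:
  assumes "linear_form f"
  shows "pairing3 (\<lambda>x y z. f (x * \<beta> * S y * \<alpha> * z)) \<Psi> = f 1"
  unfolding linear_form_contract3[OF assms, symmetric] antipode_associator_inverse ..

text \<open>A factor \<open>(1 \<otimes> \<Delta> \<otimes> 1)\<Phi>\<close> whose middle legs meet around \<open>\<alpha>\<close> (below: around \<open>\<beta>\<close>) disappears, by
  \<open>(1 \<otimes> \<epsilon> \<otimes> 1)\<Phi> = 1\<close>.\<close>

lemma pairing_antipode_left_middle:
  assumes N: "trilinear_form N"
  shows "pairing3 (\<lambda>X Y Z. pairing2 (\<lambda>y1 y2. N X (S y1 * \<alpha> * y2) Z) (\<Delta> Y)) \<Phi> = N 1 \<alpha> 1"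
proof -
  have "linear_form (\<lambda>w. N X w Z)" for X Z
    using N by (simp add: form_simps)
  moreover have "bilinear_form (\<lambda>x z. N x \<alpha> z)"
    using N by (simp add: form_simps)
  ultimately show ?thesis
    by (simp only: pairing_antipode_left[of "\<lambda>w. N _ w _"] pairing_counit_middle)
qed

lemma pairing_antipode_right_middle:
  assumes N: "trilinear_form N"
  shows "pairing3 (\<lambda>X Y Z. pairing2 (\<lambda>y1 y2. N X (y1 * \<beta> * S y2) Z) (\<Delta> Y)) \<Phi> = N 1 \<beta> 1"
proof -
  have "linear_form (\<lambda>w. N X w Z)" for X Z
    using N by (simp add: form_simps)
  moreover have "bilinear_form (\<lambda>x z. N x \<beta> z)"
    using N by (simp add: form_simps)
  ultimately show ?thesis
    by (simp only: pairing_antipode_right[of "\<lambda>w. N _ w _"] pairing_counit_middle)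
qed

text \<open>The typical example is \<open>\<tau>(p, q) = h(S(p) \<alpha> q)\<close> for a linear form \<open>h\<close>; its invariance is the axiom for
  \<open>\<alpha>\<close>.\<close>

definition invariant_form :: "('h \<Rightarrow> 'h \<Rightarrow> 'k) \<Rightarrow> bool" where
  "invariant_form \<tau> \<longleftrightarrow> bilinear_form \<tau> \<and>
     (\<forall>a p q. pairing2 (\<lambda>a1 a2. \<tau> (a1 * p) (a2 * q)) (\<Delta> a) = \<epsilon> a * \<tau> p q)"

text \<open>The identity \<open>\<Theta>(1, S(a) c) = \<Theta>(a, c)\<close> for \<open>\<Theta>(p, c) = \<Sum> \<tau>(X p, Y \<beta> S(Z) c)\<close>. Both sides evaluate the form
  \<open>\<tau>(x, y \<beta> S(z) c)\<close> on the two sides of \<open>(\<Delta> \<otimes> 1)\<Delta>(a) \<Phi> = \<Phi> (1 \<otimes> \<Delta>)\<Delta>(a)\<close>: on the left the first two legs of \<open>a\<close> are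
  absorbed by invariance, on the right the last two legs are absorbed by \<open>\<beta>\<close>.\<close>

lemma invariant_form_antipode:
  assumes "invariant_form \<tau>"
  shows "pairing3 (\<lambda>X Y Z. \<tau> X (Y * \<beta> * S Z * (S a * c))) \<Phi>
    = pairing3 (\<lambda>X Y Z. \<tau> (X * a) (Y * \<beta> * S Z * c)) \<Phi>"
proof -
  have \<tau>: "bilinear_form \<tau>"
    and inv: "pairing2 (\<lambda>a1 a2. \<tau> (a1 * p) (a2 * q)) (\<Delta> a) = \<epsilon> a * \<tau> p q" for a p q
    using assms by (auto simp: invariant_form_def)
  note lin = \<tau>[unfolded form_defs, simplified]
  have "trilinear_form (\<lambda>x y z. \<tau> x (y * \<beta> * S z * c))"
    by (simp add: qh_form_simps lin)
  note coassoc = pairing_quasi_coassociative[OF this, of a]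
  have lf: "linear_form (\<lambda>z. \<tau> x (y * z * w))" for x y w
    by (simp add: qh_form_simps lin)
  have right: "pairing2 (\<lambda>b c'. \<tau> (X * a1) (Y * b * \<beta> * S (Z * c') * c)) (\<Delta> a2)
    = \<epsilon> a2 * \<tau> (X * a1) (Y * \<beta> * (S Z * c))" for X Y Z a1 a2
    using pairing_antipode_right[OF lf[of "X * a1" Y "S Z * c"], of a2]
    by (simp add: antipode_mult mult.assoc)
  have "pairing3 (\<lambda>X Y Z. \<tau> X (Y * \<beta> * S Z * (S a * c))) \<Phi>
    = pairing2 (\<lambda>a1 a2. \<epsilon> a1 * pairing3 (\<lambda>X Y Z. \<tau> X (Y * \<beta> * S (a2 * Z) * c)) \<Phi>) (\<Delta> a)"
    by (subst pairing_counit_left) (simp_all add: qh_form_simps lin mult.assoc)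
  also have "\<dots> = pairing2 (\<lambda>a1 a2. pairing2 (\<lambda>b c'. pairing3 (\<lambda>X Y Z.
      \<tau> (b * X) (c' * Y * \<beta> * S (a2 * Z) * c)) \<Phi>) (\<Delta> a1)) (\<Delta> a)"
    by (simp add: pairing_swap23 mult.assoc inv pairing3_scale)
  also note coassoc[symmetric]
  also have "pairing3 (\<lambda>X Y Z. pairing2 (\<lambda>a1 a2. pairing2 (\<lambda>b c'.
      \<tau> (X * a1) (Y * b * \<beta> * S (Z * c') * c)) (\<Delta> a2)) (\<Delta> a)) \<Phi>
    = pairing3 (\<lambda>X Y Z. \<tau> (X * a) (Y * \<beta> * S Z * c)) \<Phi>"
  proof -
    have "linear_form (\<lambda>a1. \<tau> (X * a1) (Y * \<beta> * (S Z * c)))" for X Y Z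
      by (simp add: qh_form_simps lin)
    from pairing_counit_right[OF this, of _ _ _ a] show ?thesis
      by (simp add: right) (simp add: mult.assoc)
  qed
  finally show ?thesis .
qed

text \<open>The identity \<open>\<Theta>(p, \<alpha> e) = \<tau>(p, e)\<close>. The form \<open>\<tau>(a p, b \<beta> S(c) \<alpha> d e)\<close> is evaluated on
  \<open>(\<Phi> \<otimes> 1) (1 \<otimes> \<Delta> \<otimes> 1)\<Phi> = (\<Delta> \<otimes> 1 \<otimes> 1)\<Phi> (1 \<otimes> 1 \<otimes> \<Delta>)\<Phi> (1 \<otimes> \<Phi>\<^sup>-\<^sup>1)\<close>. On the left the two middle legs meet around \<open>\<beta>\<close>.
  On the right the first tensor is absorbed by invariance, the second by \<open>\<alpha>\<close>, and the third one leaves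
  \<open>\<Sum> X' \<beta> S(Y') \<alpha> Z' = 1\<close>.\<close>

lemma invariant_form_associator:
  assumes "invariant_form \<tau>"
  shows "pairing3 (\<lambda>X Y Z. \<tau> (X * p) (Y * \<beta> * S Z * (\<alpha> * e))) \<Phi> = \<tau> p e"
proof -
  have \<tau>: "bilinear_form \<tau>"
    and inv: "pairing2 (\<lambda>a1 a2. \<tau> (a1 * p) (a2 * q)) (\<Delta> a) = \<epsilon> a * \<tau> p q" for a p q
    using assms by (auto simp: invariant_form_def)
  note lin = \<tau>[unfolded form_defs, simplified]
  have "quadrilinear_form (\<lambda>a b c d. \<tau> (a * p) (b * \<beta> * S c * \<alpha> * d * e))"
    by (simp add: qh_form_simps lin)
  note pentagon = pairing_pentagon_right[OF this]
  have "pairing3 (\<lambda>X Y Z. \<tau> (X * p) (Y * \<beta> * S Z * (\<alpha> * e))) \<Phi>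
    = pairing3 (\<lambda>X Y Z. pairing3 (\<lambda>X' Y' Z'. pairing2 (\<lambda>y1 y2.
      \<tau> (X * X' * p) (Y * y1 * \<beta> * S (Z * y2) * \<alpha> * Z' * e)) (\<Delta> Y')) \<Phi>) \<Phi>"
  proof (rule pairing3_cong)
    fix X Y Z
    have "trilinear_form (\<lambda>x w z. \<tau> (X * x * p) (Y * w * S Z * \<alpha> * z * e))"
      by (simp add: qh_form_simps lin)
    from pairing_antipode_right_middle[OF this]
    show "\<tau> (X * p) (Y * \<beta> * S Z * (\<alpha> * e)) = pairing3 (\<lambda>X' Y' Z'. pairing2 (\<lambda>y1 y2.
      \<tau> (X * X' * p) (Y * y1 * \<beta> * S (Z * y2) * \<alpha> * Z' * e)) (\<Delta> Y')) \<Phi>"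
      by (simp add: antipode_mult mult.assoc)
  qed
  also note pentagon
  also have "pairing3 (\<lambda>X Y Z. pairing2 (\<lambda>x1 x2. pairing3 (\<lambda>X' Y' Z'. pairing2 (\<lambda>z1 z2.
      pairing3 (\<lambda>U V W. \<tau> (x1 * X' * p) (x2 * Y' * U * \<beta> * S (Y * z1 * V) * \<alpha> * (Z * z2 * W) * e))
      \<Psi>) (\<Delta> Z')) \<Phi>) (\<Delta> X)) \<Phi>
    = pairing3 (\<lambda>X Y Z. \<epsilon> X * pairing3 (\<lambda>X' Y' Z'. pairing2 (\<lambda>z1 z2.
      pairing3 (\<lambda>U V W. \<tau> (X' * p) (Y' * U * \<beta> * S (Y * z1 * V) * \<alpha> * (Z * z2 * W) * e))
      \<Psi>) (\<Delta> Z')) \<Phi>) \<Phi>"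
    by (simp add: pairing_swap23 pairing_swap22[of _ "\<Delta> _" "\<Delta> X" for X] mult.assoc inv pairing2_scale pairing3_scale)
  also have "\<dots> = pairing3 (\<lambda>X Y Z. pairing2 (\<lambda>z1 z2.
      pairing3 (\<lambda>U V W. \<tau> (X * p) (Y * U * \<beta> * S (z1 * V) * \<alpha> * (z2 * W) * e)) \<Psi>) (\<Delta> Z)) \<Phi>"
    by (subst pairing_counit_associator_left) (simp_all add: qh_form_simps lin)
  also have "\<dots> = pairing3 (\<lambda>X Y Z. \<epsilon> Z * pairing3 (\<lambda>U V W.
      \<tau> (X * p) (Y * U * \<beta> * S V * \<alpha> * W * e)) \<Psi>) \<Phi>"
  proof (rule pairing3_cong)
    fix X Y Z
    have "linear_form (\<lambda>w. pairing3 (\<lambda>U V W. \<tau> (X * p) (Y * U * \<beta> * S V * w * W * e)) \<Psi>)"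
      by (simp add: qh_form_simps lin)
    from pairing_antipode_left[OF this, of Z]
    show "pairing2 (\<lambda>z1 z2. pairing3 (\<lambda>U V W.
        \<tau> (X * p) (Y * U * \<beta> * S (z1 * V) * \<alpha> * (z2 * W) * e)) \<Psi>) (\<Delta> Z)
      = \<epsilon> Z * pairing3 (\<lambda>U V W. \<tau> (X * p) (Y * U * \<beta> * S V * \<alpha> * W * e)) \<Psi>"
      by (simp add: antipode_mult mult.assoc)
  qed
  also have "\<dots> = pairing3 (\<lambda>U V W. \<tau> p (U * \<beta> * S V * \<alpha> * W * e)) \<Psi>"
    by (subst pairing_counit_associator_right) (simp_all add: qh_form_simps lin)
  also have "\<dots> = \<tau> p e"
  proof -
    have "linear_form (\<lambda>w. \<tau> p (w * e))" by (simp add: form_simps lin)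
    from pairing_antipode_associator_inverse[OF this] show ?thesis by simp
  qed
  finally show ?thesis .
qed

text \<open>With \<open>\<Theta>\<close> as above, \<open>\<Theta>(1, 1) = \<Sum> \<Theta>(1, X' \<beta> S(Y') \<alpha> Z') = \<Sum> \<Theta>(S\<^sup>-\<^sup>1(X' \<beta> S(Y')), \<alpha> Z')\<close>, and the last sum is
  \<open>\<Sum> \<tau>(S\<^sup>-\<^sup>1(X' \<beta> S(Y')), Z')\<close>.\<close>

lemma invariant_form_twist:
  assumes "invariant_form \<tau>"
  shows "pairing3 (\<lambda>X Y Z. \<tau> X (Y * \<beta> * S Z)) \<Phi>
    = pairing3 (\<lambda>X Y Z. \<tau> (inv S (X * \<beta> * S Y)) Z) \<Psi>"
proof -
  have \<tau>: "bilinear_form \<tau>"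
    using assms by (auto simp: invariant_form_def)
  note lin = \<tau>[unfolded form_defs, simplified]
  have S_inv: "S (inv S a) = a" for a
    using antipode_bij by (simp add: bij_is_surj surj_f_inv_f)
  have "linear_form (\<lambda>w. pairing3 (\<lambda>X Y Z. \<tau> X (Y * \<beta> * S Z * w)) \<Phi>)"
    by (simp add: qh_form_simps lin)
  from pairing_antipode_associator_inverse[OF this]
  have "pairing3 (\<lambda>X Y Z. \<tau> X (Y * \<beta> * S Z)) \<Phi>
    = pairing3 (\<lambda>x y z. pairing3 (\<lambda>X Y Z. \<tau> X (Y * \<beta> * S Z * (x * \<beta> * S y * \<alpha> * z))) \<Phi>) \<Psi>"
    by simp
  also have "\<dots> = pairing3 (\<lambda>X Y Z. \<tau> (inv S (X * \<beta> * S Y)) Z) \<Psi>"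
  proof (rule pairing3_cong)
    fix x y z
    show "pairing3 (\<lambda>X Y Z. \<tau> X (Y * \<beta> * S Z * (x * \<beta> * S y * \<alpha> * z))) \<Phi>
      = \<tau> (inv S (x * \<beta> * S y)) z"
      using invariant_form_antipode[OF assms, of "inv S (x * \<beta> * S y)" "\<alpha> * z"]
        invariant_form_associator[OF assms, of "inv S (x * \<beta> * S y)" z]
      by (simp add: S_inv mult.assoc)
  qed
  finally show ?thesis .
qed

end

section \<open>The Drinfeld twist under evaluation\<close>

context k_algebra
begin

text \<open>Stated for arbitrary data, so as to apply to \<open>H\<close> and to \<open>H\<^sup>c\<^sup>o\<^sup>p\<close> alike, as are the next lemmas.\<close>

lemma pairing_gamma_tensor:
  assumes g: "quadrilinear_form g"
  shows "pairing4 g ((w \<boxtimes> \<iota> 1) \<odot> tensor_map [D, \<iota>, \<iota>] t)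
    = pairing3 (\<lambda>U V W. pairing3 (\<lambda>X Y Z. pairing2 (\<lambda>x1 x2.
        g (U * x1) (V * x2) (W * Y) Z) (D X)) t) w"
proof -
  note lin = g[unfolded form_defs, simplified]
  have "quadrilinear_form (\<lambda>a b c d. g (p * a) (q * b) (r * c) (s * d))" for p q r s
    by (simp add: form_simps lin)
  moreover have "quadrilinear_form (\<lambda>a b c d. pairing3 (\<lambda>X Y Z. pairing2 (\<lambda>x1 x2.
      g (a * x1) (b * x2) (c * Y) (d * Z)) (D X)) t)"
    by (simp add: form_simps lin)
  ultimately show ?thesis
    using g by (simp add: pairing4_mult pairing_coproduct_id_id pairing_tensor_one_right)
qed

lemma pairing_drinfeld_gamma:
  assumes m: "bilinear_form m"
  shows "pairing2 m (drinfeld_gamma D t s a)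
    = pairing4 (\<lambda>A B C E. m (s B * a * C) (s A * a * E))
        ((tensor_inverse 3 t \<boxtimes> \<iota> 1) \<odot> tensor_map [D, \<iota>, \<iota>] t)"
proof -
  have "(\<lambda>xs. pairing (form2 m) (case xs of [a1, b, c, d] \<Rightarrow> pure_tensor [s b * a * c, s a1 * a * d]
      | _ \<Rightarrow> tensor_zero)) = form4 (\<lambda>A B C E. m (s B * a * C) (s A * a * E))"
    using m by (intro form4_cong_length[symmetric]) (auto split: list.split)
  then show ?thesis
    using m by (simp add: drinfeld_gamma_def pairing2_def pairing4_def pairing_extend)
qed

lemma pairing_drinfeld_twist:
  assumes f: "bilinear_form f"
    and s: "\<And>x y. s (x + y) = s x + s y" "\<And>c x. s (c *s x) = c *s s x"
  shows "pairing2 f (drinfeld_twist D t s a b)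
    = pairing3 (\<lambda>X Y Z. pairing2 (\<lambda>x1 x2. pairing2 (\<lambda>u v. pairing2 (\<lambda>q1 q2.
        f (s x2 * u * q1) (s x1 * v * q2)) (D (Y * b * s Z))) (drinfeld_gamma D t s a)) (D X)) t"
proof -
  note lin = f[unfolded form_defs, simplified]
  let ?\<gamma> = "drinfeld_gamma D t s a"
  have "(\<lambda>xs. pairing (form2 f) (case xs of [x, y, z] \<Rightarrow>
      map_both s (op_coproduct D x) \<odot> ?\<gamma> \<odot> D (y * b * s z) | _ \<Rightarrow> tensor_zero))
    = form3 (\<lambda>x y z. pairing2 f (map_both s (op_coproduct D x) \<odot> ?\<gamma> \<odot> D (y * b * s z)))"
    using f by (intro form3_cong_length[symmetric]) (auto simp: pairing2_def split: list.split)
  then have twist: "pairing2 f (drinfeld_twist D t s a b)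
    = pairing3 (\<lambda>X Y Z. pairing2 f (map_both s (op_coproduct D X) \<odot> ?\<gamma> \<odot> D (Y * b * s Z))) t"
    using f by (simp add: drinfeld_twist_def pairing2_def[of f "extend _ _"] pairing3_def pairing_extend)
  have factors: "pairing2 f (map_both s (op_coproduct D X) \<odot> ?\<gamma> \<odot> D q)
    = pairing2 (\<lambda>x1 x2. pairing2 (\<lambda>u v. pairing2 (\<lambda>q1 q2.
        f (s x2 * u * q1) (s x1 * v * q2)) (D q)) ?\<gamma>) (D X)" for X q
  proof -
    have lin1: "bilinear_form (\<lambda>x y. pairing2 (\<lambda>q1 q2. f (x * q1) (y * q2)) (D q))"
      by (simp add: form_simps lin)
    have lin2: "bilinear_form (\<lambda>x y. pairing2 (\<lambda>u v. pairing2 (\<lambda>q1 q2.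
        f (x * u * q1) (y * v * q2)) (D q)) ?\<gamma>)"
      by (simp add: form_simps lin)
    have lin3: "bilinear_form (\<lambda>x y. pairing2 (\<lambda>u v. pairing2 (\<lambda>q1 q2.
        f (s x * u * q1) (s y * v * q2)) (D q)) ?\<gamma>)"
      by (simp add: form_simps lin s)
    show ?thesis
      using f lin1 lin2 lin3
      by (simp add: pairing2_mult pairing2_map_both op_coproduct_def pairing2_reverse_tensor)
  qed
  show ?thesis by (simp only: twist factors)
qed

lemma homogeneous_drinfeld_twist:
  assumes "\<And>x. homogeneous 2 (D x)"
  shows "homogeneous 2 (drinfeld_twist D t s a b)"
  unfolding drinfeld_twist_def
  by (rule homogeneous_extend) (auto simp: homogeneous_tensor_zero homogeneous_mult assms split: list.split)

end

section \<open>The element \<gamma>: two formulas and its invariance\<close>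

context quasi_bialgebra
begin

abbreviation gamma_tensor :: "('k, 'h) tensor" where
  "gamma_tensor \<equiv> (\<Psi> \<boxtimes> \<iota> 1) \<odot> tensor_map [\<Delta>, \<iota>, \<iota>] \<Phi>"

text \<open>For \<open>W = (\<Phi>\<^sup>-\<^sup>1 \<otimes> 1) (\<Delta> \<otimes> 1 \<otimes> 1)\<Phi>\<close> this is \<open>W (\<Delta> \<otimes> \<Delta>)\<Delta>(a) = (1 \<otimes> \<Delta> \<otimes> 1)(\<Delta> \<otimes> 1)\<Delta>(a) W\<close>. Quasi-coassociativity moves
  \<open>a\<close> first past \<open>(\<Delta> \<otimes> 1 \<otimes> 1)\<Phi>\<close>, where it is applied to \<open>a\<close> itself, and then past \<open>\<Phi>\<^sup>-\<^sup>1 \<otimes> 1\<close>, where it is applied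
  to the first leg of \<open>\<Delta>(a)\<close>.\<close>

lemma pairing_gamma_tensor_coproduct:
  assumes g: "quadrilinear_form g"
  shows "pairing2 (\<lambda>a1 a2. pairing2 (\<lambda>a11 a12. pairing2 (\<lambda>a21 a22. pairing4 (\<lambda>A B C D.
      g (A * a11) (B * a12) (C * a21) (D * a22)) gamma_tensor) (\<Delta> a2)) (\<Delta> a1)) (\<Delta> a)
    = pairing2 (\<lambda>a1 a2. pairing2 (\<lambda>b c. pairing2 (\<lambda>c1 c2. pairing4 (\<lambda>A B C D.
      g (b * A) (c1 * B) (c2 * C) (a2 * D)) gamma_tensor) (\<Delta> c)) (\<Delta> a1)) (\<Delta> a)"
proof -
  note lin = g[unfolded form_defs, simplified]
  have right: "quadrilinear_form (\<lambda>A B C D. g (A * p) (B * q) (C * r) (D * s))"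
    and left: "quadrilinear_form (\<lambda>A B C D. g (p * A) (q * B) (r * C) (s * D))" for p q r s
    by (simp_all add: form_simps lin)
  have split: "pairing2 (\<lambda>x1 x2. pairing2 (\<lambda>b1 b2. g (U * (x1 * b1)) (V * (x2 * b2)) y z) (\<Delta> b)) (\<Delta> X)
    = pairing2 (\<lambda>u v. g (U * u) (V * v) y z) (\<Delta> (X * b))" for U V y z X b
  proof -
    have "bilinear_form (\<lambda>u v. g (U * u) (V * v) y z)" by (simp add: form_simps lin)
    from pairing_coproduct_mult[OF this] show ?thesis ..
  qed
  have "pairing2 (\<lambda>a1 a2. pairing2 (\<lambda>a11 a12. pairing2 (\<lambda>a21 a22. pairing4 (\<lambda>A B C D.
      g (A * a11) (B * a12) (C * a21) (D * a22)) gamma_tensor) (\<Delta> a2)) (\<Delta> a1)) (\<Delta> a)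
    = pairing3 (\<lambda>U V W. pairing3 (\<lambda>X Y Z. pairing2 (\<lambda>a1 a2. pairing2 (\<lambda>b1 b2. pairing2 (\<lambda>a21 a22.
        pairing2 (\<lambda>x1 x2. g (U * x1 * b1) (V * x2 * b2) (W * Y * a21) (Z * a22))
          (\<Delta> X)) (\<Delta> a2)) (\<Delta> a1)) (\<Delta> a)) \<Phi>) \<Psi>"
    by (simp only: pairing_gamma_tensor[OF right] pairing_swap23)
  also have "\<dots> = pairing3 (\<lambda>U V W. pairing3 (\<lambda>X Y Z. pairing2 (\<lambda>a1 a2. pairing2 (\<lambda>a21 a22.
        pairing2 (\<lambda>x1 x2. pairing2 (\<lambda>b1 b2. g (U * x1 * b1) (V * x2 * b2) (W * Y * a21) (Z * a22))
          (\<Delta> a1)) (\<Delta> X)) (\<Delta> a2)) (\<Delta> a)) \<Phi>) \<Psi>"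
    by (intro pairing3_cong pairing2_cong) (rule pairing_rotate222)
  also have "\<dots> = pairing3 (\<lambda>U V W. pairing3 (\<lambda>X Y Z. pairing2 (\<lambda>a1 a2. pairing2 (\<lambda>a21 a22.
        pairing2 (\<lambda>u v. g (U * u) (V * v) (W * (Y * a21)) (Z * a22)) (\<Delta> (X * a1)))
          (\<Delta> a2)) (\<Delta> a)) \<Phi>) \<Psi>"
    by (simp only: split mult.assoc)
  also have "\<dots> = pairing3 (\<lambda>U V W. pairing2 (\<lambda>a1 a2. pairing2 (\<lambda>b c. pairing3 (\<lambda>X Y Z.
        pairing2 (\<lambda>u v. g (U * u) (V * v) (W * (c * Y)) (a2 * Z)) (\<Delta> (b * X)))
          \<Phi>) (\<Delta> a1)) (\<Delta> a)) \<Psi>"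
  proof (rule pairing3_cong)
    fix U V W
    have "trilinear_form (\<lambda>x y z. pairing2 (\<lambda>u v. g (U * u) (V * v) (W * y) z) (\<Delta> x))"
      by (simp add: qb_form_simps lin)
    from pairing_quasi_coassociative[OF this, of a]
    show "pairing3 (\<lambda>X Y Z. pairing2 (\<lambda>a1 a2. pairing2 (\<lambda>a21 a22.
        pairing2 (\<lambda>u v. g (U * u) (V * v) (W * (Y * a21)) (Z * a22)) (\<Delta> (X * a1)))
          (\<Delta> a2)) (\<Delta> a)) \<Phi>
      = pairing2 (\<lambda>a1 a2. pairing2 (\<lambda>b c. pairing3 (\<lambda>X Y Z.
        pairing2 (\<lambda>u v. g (U * u) (V * v) (W * (c * Y)) (a2 * Z)) (\<Delta> (b * X)))
          \<Phi>) (\<Delta> a1)) (\<Delta> a)" .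
  qed
  also have "\<dots> = pairing3 (\<lambda>U V W. pairing2 (\<lambda>a1 a2. pairing2 (\<lambda>b c. pairing2 (\<lambda>b1 b2.
        pairing3 (\<lambda>X Y Z. pairing2 (\<lambda>x1 x2. g (U * b1 * x1) (V * b2 * x2) (W * c * Y) (a2 * Z))
          (\<Delta> X)) \<Phi>) (\<Delta> b)) (\<Delta> a1)) (\<Delta> a)) \<Psi>"
    by (simp only: split[symmetric] pairing_swap23 mult.assoc)
  also have "\<dots> = pairing2 (\<lambda>a1 a2. pairing2 (\<lambda>b c. pairing2 (\<lambda>c1 c2. pairing3 (\<lambda>U V W.
        pairing3 (\<lambda>X Y Z. pairing2 (\<lambda>x1 x2. g (b * U * x1) (c1 * V * x2) (c2 * W * Y) (a2 * Z))
          (\<Delta> X)) \<Phi>) \<Psi>) (\<Delta> c)) (\<Delta> a1)) (\<Delta> a)"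
  proof (subst pairing_swap23[symmetric], rule pairing2_cong)
    fix a1 a2
    have "trilinear_form (\<lambda>x y z. pairing3 (\<lambda>X Y Z. pairing2 (\<lambda>x1 x2.
        g (x * x1) (y * x2) (z * Y) (a2 * Z)) (\<Delta> X)) \<Phi>)"
      by (simp add: form_simps lin)
    from pairing_quasi_coassociative_inverse[OF this, of a1]
    show "pairing3 (\<lambda>U V W. pairing2 (\<lambda>b c. pairing2 (\<lambda>b1 b2. pairing3 (\<lambda>X Y Z.
        pairing2 (\<lambda>x1 x2. g (U * b1 * x1) (V * b2 * x2) (W * c * Y) (a2 * Z)) (\<Delta> X)) \<Phi>)
          (\<Delta> b)) (\<Delta> a1)) \<Psi>
      = pairing2 (\<lambda>b c. pairing2 (\<lambda>c1 c2. pairing3 (\<lambda>U V W. pairing3 (\<lambda>X Y Z.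
        pairing2 (\<lambda>x1 x2. g (b * U * x1) (c1 * V * x2) (c2 * W * Y) (a2 * Z)) (\<Delta> X)) \<Phi>) \<Psi>)
          (\<Delta> c)) (\<Delta> a1)" .
  qed
  also have "\<dots> = pairing2 (\<lambda>a1 a2. pairing2 (\<lambda>b c. pairing2 (\<lambda>c1 c2. pairing4 (\<lambda>A B C D.
      g (b * A) (c1 * B) (c2 * C) (a2 * D)) gamma_tensor) (\<Delta> c)) (\<Delta> a1)) (\<Delta> a)"
    by (simp only: pairing_gamma_tensor[OF left] mult.assoc)
  finally show ?thesis .
qed

end

context quasi_hopf_algebra
begin

abbreviation \<gamma> :: "('k, 'h) tensor" where
  "\<gamma> \<equiv> drinfeld_gamma \<Delta> \<Phi> S \<alpha>"

lemma quadrilinear_form_gamma: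
  "bilinear_form m \<Longrightarrow> quadrilinear_form (\<lambda>A B C D. m (S B * \<alpha> * C) (S A * \<alpha> * D))"
  by (simp add: qh_form_simps)

text \<open>The formula for \<open>\<gamma>\<close> in terms of \<open>(1 \<otimes> \<Phi>) (1 \<otimes> 1 \<otimes> \<Delta>)\<Phi>\<^sup>-\<^sup>1\<close>. By the pentagon, the two four-fold tensors differ by
  the left factor \<open>(1 \<otimes> \<Delta> \<otimes> 1)\<Phi>\<close>, whose middle legs meet around \<open>\<alpha>\<close>.\<close>

lemma pairing_gamma_alt:
  assumes m: "bilinear_form m"
  shows "pairing2 m \<gamma> = pairing3 (\<lambda>X Y Z. pairing3 (\<lambda>U V W. pairing2 (\<lambda>w1 w2.
      m (S (X * V) * \<alpha> * (Y * w1)) (S U * \<alpha> * (Z * w2))) (\<Delta> W)) \<Psi>) \<Phi>"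
proof -
  note lin = m[unfolded form_defs, simplified]
  note g = quadrilinear_form_gamma[OF m]
  have "trilinear_form (\<lambda>x n z. pairing3 (\<lambda>X Y Z. pairing3 (\<lambda>U V W. pairing2 (\<lambda>w1 w2.
      m (S (X * V) * n * (Y * w1)) (S (x * U) * \<alpha> * (z * Z * w2))) (\<Delta> W)) \<Psi>) \<Phi>)"
    by (simp add: qh_form_simps lin)
  from pairing_antipode_left_middle[OF this]
  have "pairing3 (\<lambda>X Y Z. pairing3 (\<lambda>U V W. pairing2 (\<lambda>w1 w2.
      m (S (X * V) * \<alpha> * (Y * w1)) (S U * \<alpha> * (Z * w2))) (\<Delta> W)) \<Psi>) \<Phi>
    = pairing3 (\<lambda>X Y Z. pairing2 (\<lambda>y1 y2. pairing3 (\<lambda>X' Y' Z'. pairing3 (\<lambda>U V W. pairing2 (\<lambda>w1 w2.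
      m (S (y1 * X' * V) * \<alpha> * (y2 * Y' * w1)) (S (X * U) * \<alpha> * (Z * Z' * w2))) (\<Delta> W)) \<Psi>) \<Phi>)
        (\<Delta> Y)) \<Phi>"
    by (simp add: antipode_mult mult.assoc)
  then show ?thesis
    by (simp only: pairing_drinfeld_gamma[OF m] pairing_gamma_tensor[OF g] pairing_pentagon_left[OF g])
qed

text \<open>After \<open>a\<close> has been moved to the left of the four-fold tensor, its two middle legs meet around the \<open>\<alpha>\<close> of the first factor of
  \<open>\<gamma>\<close> and disappear; then the two outer legs do the same around the \<open>\<alpha>\<close> of the second factor.\<close>

lemma gamma_invariant:
  assumes m: "bilinear_form m"
  shows "pairing2 (\<lambda>a1 a2. pairing2 (\<lambda>a11 a12. pairing2 (\<lambda>a21 a22. pairing2 (\<lambda>u v.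
      m (S a12 * u * a21) (S a11 * v * a22)) \<gamma>) (\<Delta> a2)) (\<Delta> a1)) (\<Delta> a)
    = \<epsilon> a * pairing2 m \<gamma>"
proof -
  note lin = m[unfolded form_defs, simplified]
  note lin_simps = qh_form_simps pairing4_add pairing4_scale lin
  have bil: "bilinear_form (\<lambda>u v. m (S q * u * r) (S p * v * s))" for p q r s
    by (simp add: lin_simps)
  have "pairing2 (\<lambda>a1 a2. pairing2 (\<lambda>a11 a12. pairing2 (\<lambda>a21 a22. pairing2 (\<lambda>u v.
      m (S a12 * u * a21) (S a11 * v * a22)) \<gamma>) (\<Delta> a2)) (\<Delta> a1)) (\<Delta> a)
    = pairing2 (\<lambda>a1 a2. pairing2 (\<lambda>b c. pairing2 (\<lambda>c1 c2. pairing4 (\<lambda>A B C D.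
      m (S B * (S c1 * \<alpha> * c2) * C) (S A * (S b * \<alpha> * a2) * D)) gamma_tensor) (\<Delta> c)) (\<Delta> a1)) (\<Delta> a)"
    unfolding pairing_drinfeld_gamma[OF bil]
    using pairing_gamma_tensor_coproduct[OF quadrilinear_form_gamma[OF m], of a]
    by (simp only: antipode_mult mult.assoc)
  also have "\<dots> = pairing2 (\<lambda>a1 a2. pairing2 (\<lambda>b c. \<epsilon> c * pairing4 (\<lambda>A B C D.
      m (S B * \<alpha> * C) (S A * (S b * \<alpha> * a2) * D)) gamma_tensor) (\<Delta> a1)) (\<Delta> a)"
  proof (intro pairing2_cong pairing_antipode_left)
    fix b a2
    show "linear_form (\<lambda>n. pairing4 (\<lambda>A B C D. m (S B * n * C) (S A * (S b * \<alpha> * a2) * D)) gamma_tensor)"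
      by (simp add: lin_simps)
  qed
  also have "\<dots> = pairing2 (\<lambda>a1 a2. pairing4 (\<lambda>A B C D.
      m (S B * \<alpha> * C) (S A * (S a1 * \<alpha> * a2) * D)) gamma_tensor) (\<Delta> a)"
  proof (intro pairing2_cong pairing_counit_right)
    fix a2
    show "linear_form (\<lambda>b. pairing4 (\<lambda>A B C D. m (S B * \<alpha> * C) (S A * (S b * \<alpha> * a2) * D)) gamma_tensor)"
      by (simp add: lin_simps)
  qed
  also have "\<dots> = \<epsilon> a * pairing4 (\<lambda>A B C D. m (S B * \<alpha> * C) (S A * \<alpha> * D)) gamma_tensor"
  proof (rule pairing_antipode_left)
    show "linear_form (\<lambda>n. pairing4 (\<lambda>A B C D. m (S B * \<alpha> * C) (S A * n * D)) gamma_tensor)"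
      by (simp add: lin_simps)
  qed
  finally show ?thesis by (simp only: pairing_drinfeld_gamma[OF m])
qed

text \<open>For \<open>h\<close> regarded as a linear form on \<open>H \<otimes> H\<close>, this is \<open>h((S \<otimes> S)\<Delta>\<^sup>T(p) \<gamma> \<Delta>(q))\<close>.\<close>

definition sandwich :: "('h \<Rightarrow> 'h \<Rightarrow> 'k) \<Rightarrow> 'h \<Rightarrow> 'h \<Rightarrow> 'k" where
  "sandwich h p q = pairing2 (\<lambda>p1 p2. pairing2 (\<lambda>u v. pairing2 (\<lambda>q1 q2.
     h (S p2 * u * q1) (S p1 * v * q2)) (\<Delta> q)) \<gamma>) (\<Delta> p)"

lemma invariant_form_sandwich:
  assumes h: "bilinear_form h"
  shows "invariant_form (sandwich h)"
  unfolding invariant_form_def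
proof (intro conjI allI)
  note lin = h[unfolded form_defs, simplified]
  show "bilinear_form (sandwich h)"
    by (simp add: sandwich_def[abs_def] qh_form_simps lin)
  fix a p q
  let ?m = "\<lambda>p1 p2 q1 q2 u v. h (S p2 * u * q1) (S p1 * v * q2)"
  have expand: "sandwich h (a1 * p) (a2 * q)
    = pairing2 (\<lambda>p1 p2. pairing2 (\<lambda>q1 q2. pairing2 (\<lambda>a11 a12. pairing2 (\<lambda>a21 a22. pairing2 (\<lambda>u v.
        ?m p1 p2 q1 q2 (S a12 * u * a21) (S a11 * v * a22)) \<gamma>) (\<Delta> a2)) (\<Delta> a1)) (\<Delta> q)) (\<Delta> p)" for a1 a2
  proof -
    have right: "bilinear_form (\<lambda>q1 q2. h (x * q1) (y * q2))" for x y
      by (simp add: form_simps lin)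
    have left: "bilinear_form (\<lambda>p1 p2. pairing2 (\<lambda>u v. pairing2 (\<lambda>a21 a22. pairing2 (\<lambda>q1 q2.
        h (S p2 * u * (a21 * q1)) (S p1 * v * (a22 * q2))) (\<Delta> q)) (\<Delta> a2)) \<gamma>)"
      by (simp add: qh_form_simps lin)
    have "sandwich h (a1 * p) (a2 * q)
      = pairing2 (\<lambda>a11 a12. pairing2 (\<lambda>p1 p2. pairing2 (\<lambda>u v. pairing2 (\<lambda>a21 a22. pairing2 (\<lambda>q1 q2.
        h (S (a12 * p2) * u * (a21 * q1)) (S (a11 * p1) * v * (a22 * q2)))
        (\<Delta> q)) (\<Delta> a2)) \<gamma>) (\<Delta> p)) (\<Delta> a1)"
      by (simp only: sandwich_def pairing_coproduct_mult[OF right] pairing_coproduct_mult[OF left])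
    also have "\<dots> = pairing2 (\<lambda>p1 p2. pairing2 (\<lambda>q1 q2. pairing2 (\<lambda>a11 a12. pairing2 (\<lambda>a21 a22. pairing2 (\<lambda>u v.
        h (S (a12 * p2) * u * (a21 * q1)) (S (a11 * p1) * v * (a22 * q2)))
        \<gamma>) (\<Delta> a2)) (\<Delta> a1)) (\<Delta> q)) (\<Delta> p)"
      by (simp only: pairing_swap22[of _ "\<Delta> p" "\<Delta> a1"] pairing_swap22[of _ "\<Delta> q" "\<Delta> a1"]
        pairing_swap22[of _ "\<Delta> q" "\<Delta> a2"] pairing_swap22[of _ "\<Delta> q" \<gamma>]
        pairing_swap22[of _ "\<Delta> a2" \<gamma>])
    finally show ?thesis by (simp only: antipode_mult mult.assoc)
  qed
  have bil: "bilinear_form (?m p1 p2 q1 q2)" for p1 p2 q1 q2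
    by (simp add: form_simps lin)
  have "pairing2 (\<lambda>a1 a2. sandwich h (a1 * p) (a2 * q)) (\<Delta> a)
    = pairing2 (\<lambda>p1 p2. pairing2 (\<lambda>q1 q2. pairing2 (\<lambda>a1 a2. pairing2 (\<lambda>a11 a12. pairing2 (\<lambda>a21 a22.
        pairing2 (\<lambda>u v. ?m p1 p2 q1 q2 (S a12 * u * a21) (S a11 * v * a22)) \<gamma>)
        (\<Delta> a2)) (\<Delta> a1)) (\<Delta> a)) (\<Delta> q)) (\<Delta> p)"
    unfolding expand by (rule pairing_rotate222)
  also have "\<dots> = pairing2 (\<lambda>p1 p2. pairing2 (\<lambda>q1 q2. \<epsilon> a * pairing2 (?m p1 p2 q1 q2) \<gamma>) (\<Delta> q)) (\<Delta> p)"
    by (intro pairing2_cong gamma_invariant bil)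
  also have "\<dots> = \<epsilon> a * sandwich h p q"
    unfolding sandwich_def pairing2_scale
    by (intro arg_cong[where f = "(*) _"] pairing2_cong) (rule pairing_swap22)
  finally show "pairing2 (\<lambda>a1 a2. sandwich h (a1 * p) (a2 * q)) (\<Delta> a) = \<epsilon> a * sandwich h p q" .
qed

section \<open>The twist of the opposite quasi-Hopf algebra\<close>

text \<open>The second formula for the twist, \<open>\<Sum> \<Delta>'(X' \<beta> S(Y')) \<gamma> \<Delta>(Z')\<close> with \<open>\<Delta>' = (S \<otimes> S)\<Delta>\<^sup>T S\<^sup>-\<^sup>1\<close>.\<close>

lemma pairing_twist:
  assumes "bilinear_form h"
  shows "pairing2 h (drinfeld_twist \<Delta> \<Phi> S \<alpha> \<beta>)
    = pairing3 (\<lambda>X Y Z. sandwich h (inv S (X * \<beta> * S Y)) Z) \<Psi>"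
  unfolding pairing_drinfeld_twist[OF assms antipode_simps]
  using invariant_form_twist[OF invariant_form_sandwich[OF assms]]
  by (simp only: sandwich_def)

lemma antipode_inverse [simp]: "S (inv S a) = a" "inv S (S a) = a"
  using antipode_bij by (simp_all add: bij_is_surj surj_f_inv_f bij_is_inj)

lemma inverse_antipode_simps:
  "inv S (a + b) = inv S a + inv S b" "inv S (c *s a) = c *s inv S a"
  "inv S (a * b) = inv S b * inv S a"
  by (rule injD[OF bij_is_inj[OF antipode_bij]], simp add: antipode_simps antipode_mult)+

text \<open>The four-fold tensor of \<open>H\<^sup>c\<^sup>o\<^sup>p\<close> is the reversal of
  \<open>(1 \<otimes> \<Phi>) (1 \<otimes> 1 \<otimes> \<Delta>)\<Phi>\<^sup>-\<^sup>1 = \<Sum> A \<otimes> B \<otimes> C \<otimes> D\<close>, so the element \<open>\<gamma>\<close> of \<open>H\<^sup>c\<^sup>o\<^sup>p\<close> is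
  \<open>\<Sum> S\<^sup>-\<^sup>1(C) S\<^sup>-\<^sup>1(\<alpha>) B \<otimes> S\<^sup>-\<^sup>1(D) S\<^sup>-\<^sup>1(\<alpha>) A = (S\<^sup>-\<^sup>1 \<otimes> S\<^sup>-\<^sup>1)(\<Sum> S(B) \<alpha> C \<otimes> S(A) \<alpha> D)\<close>.\<close>

lemma pairing_opposite_gamma:
  assumes m: "bilinear_form m"
  shows "pairing2 m (drinfeld_gamma (op_coproduct \<Delta>) (op_associator \<Phi>) (inv S) (inv S \<alpha>))
    = pairing2 (\<lambda>u v. m (inv S u) (inv S v)) \<gamma>"
proof -
  note lin = m[unfolded form_defs, simplified]
  note lin_simps = qb_form_simps inverse_antipode_simps lin
  have m': "bilinear_form (\<lambda>u v. m (inv S u) (inv S v))"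
    by (simp add: lin_simps)
  have op_inverse: "tensor_inverse 3 (op_associator \<Phi>) = reverse_tensor \<Phi>"
    unfolding op_associator_def
    by (intro tensor_inverse3_eq reverse_tensor_inverse3 inverse_associator associator_in_power)
  have quad: "quadrilinear_form (\<lambda>A B C D. m (inv S B * inv S \<alpha> * C) (inv S A * inv S \<alpha> * D))"
    by (simp add: lin_simps)
  have lin1: "bilinear_form (\<lambda>x1 x2. m (inv S (V * x2) * inv S \<alpha> * (W * Y)) (inv S (U * x1) * inv S \<alpha> * Z))"
    for U V W Y Z
    by (simp add: lin_simps)
  have lin2: "trilinear_form (\<lambda>X Y Z. pairing2 (\<lambda>x1 x2.
      m (inv S (V * x1) * inv S \<alpha> * (W * Y)) (inv S (U * x2) * inv S \<alpha> * Z)) (\<Delta> X))" for U V W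
    by (simp add: lin_simps)
  have lin3: "trilinear_form (\<lambda>U V W. pairing3 (\<lambda>X Y Z. pairing2 (\<lambda>x1 x2.
      m (inv S (V * x1) * inv S \<alpha> * (W * Y)) (inv S (U * x2) * inv S \<alpha> * X)) (\<Delta> Z)) \<Psi>)"
    by (simp add: lin_simps)
  have "pairing2 m (drinfeld_gamma (op_coproduct \<Delta>) (op_associator \<Phi>) (inv S) (inv S \<alpha>))
    = pairing3 (\<lambda>W V U. pairing3 (\<lambda>X Y Z. pairing2 (\<lambda>x1 x2.
      m (inv S (V * x1) * inv S \<alpha> * (W * Y)) (inv S (U * x2) * inv S \<alpha> * X)) (\<Delta> Z)) \<Psi>) \<Phi>"
    unfolding pairing_drinfeld_gamma[OF m] pairing_gamma_tensor[OF quad] op_inverse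
    by (simp only: op_associator_def op_coproduct_def pairing2_reverse_tensor[OF lin1]
        pairing3_reverse_tensor[OF lin2] pairing3_reverse_tensor[OF lin3])
  then show ?thesis
    unfolding pairing_gamma_alt[OF m']
    by (simp only: inverse_antipode_simps antipode_inverse mult.assoc)
qed

text \<open>The twist of \<open>H\<^sup>c\<^sup>o\<^sup>p\<close> is
  \<open>\<Sum> (S\<^sup>-\<^sup>1 \<otimes> S\<^sup>-\<^sup>1)\<Delta>(Z') \<cdot> (S\<^sup>-\<^sup>1 \<otimes> S\<^sup>-\<^sup>1)\<gamma> \<cdot> \<Delta>\<^sup>T(S\<^sup>-\<^sup>1(X' \<beta> S(Y')))\<close>; pulling out the anti-homomorphism \<open>S\<^sup>-\<^sup>1 \<otimes> S\<^sup>-\<^sup>1\<close>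
  reverses the three factors and leaves \<open>\<Sum> \<Delta>'(X' \<beta> S(Y')) \<gamma> \<Delta>(Z')\<close>.\<close>

lemma pairing_opposite_twist:
  assumes f: "bilinear_form f"
  shows "pairing2 f (drinfeld_twist (op_coproduct \<Delta>) (op_associator \<Phi>) (inv S) (inv S \<alpha>) (inv S \<beta>))
    = pairing3 (\<lambda>X Y Z. sandwich (\<lambda>a b. f (inv S a) (inv S b)) (inv S (X * \<beta> * S Y)) Z) \<Psi>"
proof -
  note lin = f[unfolded form_defs, simplified]
  note lin_simps = qb_form_simps inverse_antipode_simps lin
  let ?S = "inv S"
  have lin1: "bilinear_form (\<lambda>q1 q2. f (x * q1) (y * q2))" for x y
    by (simp add: lin_simps)
  have lin2: "bilinear_form (\<lambda>u v. pairing2 (\<lambda>q1 q2. f (x * u * q2) (y * v * q1)) (\<Delta> q))" for x y q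
    by (simp add: lin_simps)
  have lin3: "bilinear_form (\<lambda>x1 x2. pairing2 (\<lambda>u v. pairing2 (\<lambda>q1 q2.
      f (?S x2 * ?S u * q2) (?S x1 * ?S v * q1)) (\<Delta> q)) \<gamma>)" for q
    by (simp add: lin_simps)
  have lin4: "trilinear_form (\<lambda>X Y Z. pairing2 (\<lambda>x1 x2. pairing2 (\<lambda>u v. pairing2 (\<lambda>q1 q2.
      f (?S x1 * ?S u * q2) (?S x2 * ?S v * q1)) (\<Delta> (Y * ?S \<beta> * ?S Z))) \<gamma>) (\<Delta> X))"
    by (simp add: lin_simps)
  have "pairing2 f (drinfeld_twist (op_coproduct \<Delta>) (op_associator \<Phi>) ?S (?S \<alpha>) (?S \<beta>))
    = pairing3 (\<lambda>X Y Z. pairing2 (\<lambda>x1 x2. pairing2 (\<lambda>u v. pairing2 (\<lambda>q1 q2.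
        f (?S x1 * ?S u * q2) (?S x2 * ?S v * q1)) (\<Delta> (Y * ?S \<beta> * ?S X))) \<gamma>) (\<Delta> Z)) \<Psi>"
    by (simp only: pairing_drinfeld_twist[OF f inverse_antipode_simps(1,2)]
        op_coproduct_def[of _ "_ * _"] pairing2_reverse_tensor[OF lin1] pairing_opposite_gamma[OF lin2])
      (simp only: op_coproduct_def pairing2_reverse_tensor[OF lin3] op_associator_def pairing3_reverse_tensor[OF lin4])
  also have "\<dots> = pairing3 (\<lambda>X Y Z. sandwich (\<lambda>a b. f (?S a) (?S b)) (?S (X * \<beta> * S Y)) Z) \<Psi>"
  proof (rule pairing3_cong)
    fix X Y Z
    show "pairing2 (\<lambda>x1 x2. pairing2 (\<lambda>u v. pairing2 (\<lambda>q1 q2.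
        f (?S x1 * ?S u * q2) (?S x2 * ?S v * q1)) (\<Delta> (Y * ?S \<beta> * ?S X))) \<gamma>) (\<Delta> Z)
      = sandwich (\<lambda>a b. f (?S a) (?S b)) (?S (X * \<beta> * S Y)) Z"
      unfolding sandwich_def inverse_antipode_simps antipode_inverse mult.assoc
      by (subst pairing_rotate222, subst pairing_swap22) (rule refl)
  qed
  finally show ?thesis .
qed

lemma drinfeld_twist_opposite:
  "drinfeld_twist (op_coproduct \<Delta>) (op_associator \<Phi>) (inv S) (inv S \<alpha>) (inv S \<beta>)
    = map_both (inv S) (drinfeld_twist \<Delta> \<Phi> S \<alpha> \<beta>)"
proof (rule tensor_eqI)
  fix \<phi> :: "'h list \<Rightarrow> 'k" assume \<phi>: "multilinear_form \<phi>"
  let ?f = "\<lambda>x y. \<phi> [x, y]"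
  have f: "bilinear_form ?f" by (rule bilinear_form_word[OF \<phi>])
  then have f': "bilinear_form (\<lambda>x y. \<phi> [inv S x, inv S y])"
    by (simp add: form_simps inverse_antipode_simps)
  have "homogeneous 2 (drinfeld_twist (op_coproduct \<Delta>) (op_associator \<Phi>) (inv S) (inv S \<alpha>) (inv S \<beta>))"
    by (intro homogeneous_drinfeld_twist) (simp add: op_coproduct_def homogeneous_reverse_tensor homogeneous_structure)
  then show "pairing \<phi> (drinfeld_twist (op_coproduct \<Delta>) (op_associator \<Phi>) (inv S) (inv S \<alpha>) (inv S \<beta>))
    = pairing \<phi> (map_both (inv S) (drinfeld_twist \<Delta> \<Phi> S \<alpha> \<beta>))"
    by (simp only: homogeneous2_pairing[OF _ \<phi>] pairing_opposite_twist[OF f] pairing_map_both[OF \<phi>]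
        pairing_twist[OF f'])
qed (simp_all add: drinfeld_twist_def map_both_def tensor_map_def)

lemma reverse_second_drinfeld_twist:
  "reverse_tensor (second_drinfeld_twist \<Delta> \<Phi> S \<alpha> \<beta>) = map_both (inv S) (drinfeld_twist \<Delta> \<Phi> S \<alpha> \<beta>)"
proof (rule tensor_eqI)
  fix \<phi> :: "'h list \<Rightarrow> 'k" assume \<phi>: "multilinear_form \<phi>"
  have "bilinear_form (\<lambda>x y. \<phi> [inv S y, inv S x])"
    using bilinear_form_word[OF \<phi>] by (simp add: form_simps inverse_antipode_simps)
  then show "pairing \<phi> (reverse_tensor (second_drinfeld_twist \<Delta> \<Phi> S \<alpha> \<beta>))
    = pairing \<phi> (map_both (inv S) (drinfeld_twist \<Delta> \<Phi> S \<alpha> \<beta>))"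
    by (simp add: second_drinfeld_twist_def pairing_reverse_tensor[OF \<phi>]
        pairing_map_both[OF multilinear_form_rev[OF \<phi>]] pairing_map_both[OF \<phi>] pairing2_reverse_tensor)
qed (simp_all add: reverse_tensor_def map_both_def tensor_map_def)

end

theorem proposition4:
  fixes scale :: "'k::field \<Rightarrow> 'h::ring_1 \<Rightarrow> 'h"
    and \<Delta> :: "'h \<Rightarrow> ('k, 'h) tensor"
    and \<epsilon> :: "'h \<Rightarrow> 'k"
    and \<Phi> :: "('k, 'h) tensor"
    and S :: "'h \<Rightarrow> 'h"
    and \<alpha> \<beta> :: 'h
  assumes "quasi_hopf_algebra scale \<Delta> \<epsilon> \<Phi> S \<alpha> \<beta>"
  shows "k_algebra.drinfeld_twist scale
             (k_algebra.op_coproduct scale \<Delta>) (k_algebra.op_associator scale \<Phi>)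
             (inv S) (inv S \<alpha>) (inv S \<beta>)
           = k_algebra.map_both scale (inv S) (k_algebra.drinfeld_twist scale \<Delta> \<Phi> S \<alpha> \<beta>)
       \<and> k_algebra.map_both scale (inv S) (k_algebra.drinfeld_twist scale \<Delta> \<Phi> S \<alpha> \<beta>)
           = k_algebra.reverse_tensor scale
               (k_algebra.second_drinfeld_twist scale \<Delta> \<Phi> S \<alpha> \<beta>)"
proof -
  interpret quasi_hopf_algebra scale \<Delta> \<epsilon> \<Phi> S \<alpha> \<beta> by (rule assms)
  show ?thesis
    by (intro conjI drinfeld_twist_opposite reverse_second_drinfeld_twist[symmetric])
qed

end
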